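(* Let $n\ge1$, $\mathfrak{g}=\mathfrak{sp}(n)=\mathfrak{h}\oplus\mathfrak{m}$ with $\mathfrak{h}=\mathfrak{u}(n)$, $\mathfrak{m}=\mathfrak{sp}(n)/\mathfrak{u}(n)$. (1) Under the identifications $(A,B)\mapsto A+iB$ on $\mathfrak{m}$ and $(C,D)\mapsto C+iD$ on $\mathfrak{h}$, the vector space $\mathfrak{m}$ is represented by the matrices $A_1\in\mathfrak{gl}(n,\mathbb{C})$ with $A_1^t-A_1=0$, and the Lie subalgebra $\mathfrak{h}$ by the matrices $C_1\in\mathfrak{gl}(n,\mathbb{C})$ with $\overline{C}_1^t+C_1=0$. (2) In this representation the Lie brackets are, for $A_1,A_2\in\mathfrak{m}$ and $C_1,C_2\in\mathfrak{h}$, $$[A_1,A_2]=A_2\overline{A}_1-A_1\overline{A}_2\in\mathfrak{h},\quad [A_1,C_1]=A_1\overline{C}_1-C_1A_1\in\mathfrak{m},\quad [C_1,C_2]=C_1C_2-C_2C_1\in\mathfrak{h}.$$ (3) The restriction of the Cartan–Killing form on $\mathfrak{sp}(n)$ to $\mathfrak{m}$ is the negative-definite inner product $$\langle A_1,A_2\rangle=-8(n+1)\,\mathrm{Re}(\mathrm{tr}(A_1\overline{A}_2)).$$ (4) The vector space $\mathfrak{m}$ has dimension $n^2+n$ and rank $n$. The $n$-dimensional vector subspace $\mathfrak{a}\subset\mathfrak{m}$ generated by the real diagonal matrices is a Cartan subspace.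
   Context: $\mathfrak{sp}(n)$ is the real Lie algebra of matrices $g\in\mathfrak{gl}(2n,\mathbb{C})$ with $g\theta+\theta g^t=0$, $g^t=-\overline{g}$, $\theta=\begin{pmatrix} 0 & I \\ -I & 0 \end{pmatrix}$. The involution $\sigma(g)=\overline{g}$ splits $\mathfrak{sp}(n)=\mathfrak{h}\oplus\mathfrak{m}$ into its $+1$ eigenspace $\mathfrak{h}\cong\mathfrak{u}(n)$ and $-1$ eigenspace $\mathfrak{m}$ (denoted $\mathfrak{sp}(n)/\mathfrak{u}(n)$). Explicitly $\mathfrak{m}$ consists of $(A,B):=i\begin{pmatrix} A & B \\ B & -A \end{pmatrix}$ with $A,B$ real symmetric $n\times n$, and $\mathfrak{h}$ of $(C,D):=\begin{pmatrix} C & -D \\ D & C \end{pmatrix}$ with $C$ real skew-symmetric and $D$ real symmetric $n\times n$. The Lie bracket of $\mathfrak{sp}(n)$ is the matrix commutator of $2n\times2n$ matrices, transported by the identifications. A Cartan subspace of $\mathfrak{m}$ is a maximal abelian subspace $\mathfrak{a}\subseteq\mathfrak{m}$ that equals the centralizer of $\mathfrak{a}$ in $\mathfrak{m}$; the rank is the dimension of a Cartan subspace.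
   Formalization: In (3) the constant for the Killing form of sp(n) on m is corrected from -8(n+1) to -4(n+1) (for n=1, A_1=A_2=1 the form is -8, not -16); -8(n+1) is proved instead for the Killing form of sp(n,C) viewed as a real Lie algebra. *)

theory Defs
  imports "HOL-Analysis.Analysis"
begin

section \<open>Real Lie algebras of complex matrices\<close>

definition bracket :: "complex^'k^'k \<Rightarrow> complex^'k^'k \<Rightarrow> complex^'k^'k" where
  "bracket X Y = X ** Y - Y ** X"

text \<open>
  Trace of a real-linear map on a finite-dimensional real subspace that it maps into itself:
  the sum of the diagonal coefficients in a basis of the subspace. The value does not depend
  on the basis. For a subspace of complex matrices this is the trace over the reals.
\<close>
definition trace_on :: "'v::euclidean_space set \<Rightarrow> ('v \<Rightarrow> 'v) \<Rightarrow> real" where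
  "trace_on V f =
     (let E = (SOME E. E \<subseteq> V \<and> independent E \<and> span E = V)
      in \<Sum>e\<in>E. representation E (f e) e)"

text \<open>
  The form \<open>trace (ad X \<circ> ad Y)\<close> on a real Lie algebra \<open>L\<close> of complex matrices.
\<close>
definition killing_form ::
  "(complex^'k^'k) set \<Rightarrow> complex^'k^'k \<Rightarrow> complex^'k^'k \<Rightarrow> real" where
  "killing_form L X Y = trace_on L (\<lambda>Z. bracket X (bracket Y Z))"

definition lie_subalgebra :: "(complex^'k^'k) set \<Rightarrow> (complex^'k^'k) set \<Rightarrow> bool" where
  "lie_subalgebra K L \<longleftrightarrow> subspace K \<and> K \<subseteq> L \<and> (\<forall>X\<in>K. \<forall>Y\<in>K. bracket X Y \<in> K)"

definition neg_def_inner_product_on ::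
  "'v::real_vector set \<Rightarrow> ('v \<Rightarrow> 'v \<Rightarrow> real) \<Rightarrow> bool" where
  "neg_def_inner_product_on V f \<longleftrightarrow>
     (\<forall>x\<in>V. \<forall>y\<in>V. \<forall>z\<in>V. \<forall>r s. f (r *\<^sub>R x + s *\<^sub>R y) z = r * f x z + s * f y z) \<and>
     (\<forall>x\<in>V. \<forall>y\<in>V. f x y = f y x) \<and>
     (\<forall>x\<in>V. x \<noteq> 0 \<longrightarrow> f x x < 0)"

definition abelian_subspace :: "(complex^'k^'k) set \<Rightarrow> bool" where
  "abelian_subspace a \<longleftrightarrow> subspace a \<and> (\<forall>X\<in>a. \<forall>Y\<in>a. bracket X Y = 0)"

definition centralizer_in :: "(complex^'k^'k) set \<Rightarrow> (complex^'k^'k) set \<Rightarrow> (complex^'k^'k) set" where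
  "centralizer_in V a = {X \<in> V. \<forall>Y\<in>a. bracket X Y = 0}"

definition cartan_subspace :: "(complex^'k^'k) set \<Rightarrow> (complex^'k^'k) set \<Rightarrow> bool" where
  "cartan_subspace V a \<longleftrightarrow>
     a \<subseteq> V \<and> abelian_subspace a \<and>
     (\<forall>b. b \<subseteq> V \<and> abelian_subspace b \<and> a \<subseteq> b \<longrightarrow> b = a) \<and>
     centralizer_in V a = a"

text \<open>
  Stated as a relation, so that it asserts that Cartan subspaces exist and that all of them
  have the same dimension.
\<close>
definition has_rank :: "(complex^'k^'k) set \<Rightarrow> nat \<Rightarrow> bool" where
  "has_rank V r \<longleftrightarrow> (\<exists>a. cartan_subspace V a) \<and> (\<forall>a. cartan_subspace V a \<longrightarrow> dim a = r)"

section \<open>The symmetric Lie algebra \<open>sp(n) = u(n) \<oplus> sp(n)/u(n)\<close>\<close>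

text \<open>
  The dimension \<open>n \<ge> 1\<close> is \<open>CARD('n)\<close>, and \<open>2n \<times> 2n\<close> matrices are indexed by \<open>'n + 'n\<close>.
\<close>
definition block ::
  "'a^'n^'n \<Rightarrow> 'a^'n^'n \<Rightarrow> 'a^'n^'n \<Rightarrow> 'a^'n^'n \<Rightarrow> 'a^('n + 'n)^('n + 'n)" where
  "block P Q R S = (\<chi> i j.
     case i of
       Inl k \<Rightarrow> (case j of Inl l \<Rightarrow> P $ k $ l | Inr l \<Rightarrow> Q $ k $ l)
     | Inr k \<Rightarrow> (case j of Inl l \<Rightarrow> R $ k $ l | Inr l \<Rightarrow> S $ k $ l))"

definition theta :: "complex^('n::finite + 'n)^('n + 'n)" where
  "theta = block 0 (mat 1) (- mat 1) 0"

abbreviation cnj_mat :: "complex^'k^'k \<Rightarrow> complex^'k^'k" where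
  "cnj_mat \<equiv> map_matrix cnj"

definition sp :: "(complex^('n::finite + 'n)^('n + 'n)) set" where
  "sp = {g. g ** theta + theta ** transpose g = 0 \<and> transpose g = - cnj_mat g}"

definition sp_h :: "(complex^('n::finite + 'n)^('n + 'n)) set" where
  "sp_h = {g \<in> sp. cnj_mat g = g}"

definition sp_m :: "(complex^('n::finite + 'n)^('n + 'n)) set" where
  "sp_m = {g \<in> sp. cnj_mat g = - g}"

text \<open>
  The complexification of \<open>sp\<close>. As a real Lie algebra it contains \<open>sp\<close>, and since it is
  \<open>sp \<oplus> \<i> sp\<close>, its Killing form over the reals restricts to twice the Killing form of \<open>sp\<close>.
\<close>
definition sp_complex :: "(complex^('n::finite + 'n)^('n + 'n)) set" where
  "sp_complex = {g. g ** theta + theta ** transpose g = 0}"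

definition m_elt :: "real^'n^'n \<Rightarrow> real^'n^'n \<Rightarrow> complex^('n::finite + 'n)^('n + 'n)" where
  "m_elt A B = map_matrix (\<lambda>x. \<i> * complex_of_real x) (block A B B (- A))"

definition h_elt :: "real^'n^'n \<Rightarrow> real^'n^'n \<Rightarrow> complex^('n::finite + 'n)^('n + 'n)" where
  "h_elt C D = map_matrix complex_of_real (block C (- D) D C)"

definition cmat :: "real^'n^'n \<Rightarrow> real^'n^'n \<Rightarrow> complex^'n^'n" where
  "cmat A B = map_matrix complex_of_real A + map_matrix (\<lambda>x. \<i> * complex_of_real x) B"

text \<open>
  The identifications \<open>(A, B) \<mapsto> A + \<i>B\<close> and \<open>(C, D) \<mapsto> C + \<i>D\<close> as total functions of the
  \<open>2n \<times> 2n\<close> matrix, by reading off the blocks; see \<open>m_id_m_elt\<close> and \<open>h_id_h_elt\<close>.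
\<close>
definition m_id :: "complex^('n::finite + 'n)^('n + 'n) \<Rightarrow> complex^'n^'n" where
  "m_id g = cmat (\<chi> k l. Im (g $ Inl k $ Inl l)) (\<chi> k l. Im (g $ Inl k $ Inr l))"

definition h_id :: "complex^('n::finite + 'n)^('n + 'n) \<Rightarrow> complex^'n^'n" where
  "h_id g = cmat (\<chi> k l. Re (g $ Inl k $ Inl l)) (\<chi> k l. Re (g $ Inr k $ Inl l))"

lemma m_id_m_elt: "m_id (m_elt A B) = cmat A B"
  by (simp add: m_id_def m_elt_def block_def map_matrix_def)

lemma h_id_h_elt: "h_id (h_elt C D) = cmat C D"
  by (simp add: h_id_def h_elt_def block_def map_matrix_def)

definition real_diagonal :: "complex^'n^'n \<Rightarrow> bool" where
  "real_diagonal M \<longleftrightarrow> (\<exists>d. M = (\<chi> i j. if i = j then complex_of_real (d i) else 0))"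

definition diag_subspace :: "(complex^('n::finite + 'n)^('n + 'n)) set" where
  "diag_subspace = span {X \<in> sp_m. real_diagonal (m_id X)}"

end

theory Submission
  imports Defs
begin

text \<open>
  Multiplying \<open>2 \<times> 2\<close> blocks gives the brackets. For the Killing form, the trace of a map on a
  subspace \<open>V\<close> is the trace on the ambient space of its composition with any linear projection
  onto \<open>V\<close>. With the projection \<open>g \<mapsto> (g + theta g\<^sup>t theta) / 2\<close> onto \<open>sp_complex\<close> the
  trace of \<open>ad X \<circ> ad Y\<close> becomes a sum over matrix units and equals \<open>2 (n + 1) tr (X Y)\<close> over
  the complex numbers. Dimensions are traces of projections in the same way.

  For the rank, a complex symmetric matrix \<open>M\<close> acts on \<open>\<complex>\<^sup>n\<close> by the antilinear map
  \<open>x \<mapsto> M cnj x\<close>, which is self-adjoint for the real inner product, and two elements of \<open>sp_m\<close>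
  commute iff these maps do. A commuting family has a common unitary basis \<open>E\<close> of eigenvectors
  with real eigenvalues (simultaneous Takagi factorization), hence lies in the real span of the
  \<open>n\<close> matrices \<open>e e\<^sup>t\<close>, \<open>e \<in> E\<close>. This span is abelian, so a Cartan subspace equals it.
\<close>

section \<open>Block matrices\<close>

lemma matrix_mult_component: "(X ** Y) $ i $ j = (\<Sum>k\<in>UNIV. X $ i $ k * Y $ k $ j)"
  by (simp add: matrix_matrix_mult_def)

lemma transpose_component: "transpose X $ i $ j = X $ j $ i"
  by (simp add: transpose_def)

lemma trace_component: "trace X = (\<Sum>i\<in>UNIV. X $ i $ i)"
  by (simp add: trace_def)

lemma trace_minus: "trace (- X) = - trace X" for X :: "'a::ring_1^'n^'n"
  by (simp add: trace_component sum_negf)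

lemma matrix_add_rdistrib: "(X + Y) ** Z = X ** Z + Y ** Z" for X :: "'a::semiring_1^'n^'m"
  by (simp add: vec_eq_iff matrix_mult_component algebra_simps sum.distrib)

lemma matrix_diff_ldistrib: "X ** (Y - Z) = X ** Y - X ** Z" for X :: "'a::ring_1^'n^'m"
  by (simp add: vec_eq_iff matrix_mult_component algebra_simps sum_subtractf)

lemma matrix_diff_rdistrib: "(X - Y) ** Z = X ** Z - Y ** Z" for X :: "'a::ring_1^'n^'m"
  by (simp add: vec_eq_iff matrix_mult_component algebra_simps sum_subtractf)

lemma matrix_minus_left: "(- X) ** Y = - (X ** Y)" for X :: "'a::ring_1^'n^'m"
  by (simp add: vec_eq_iff matrix_mult_component sum_negf)

lemma matrix_minus_right: "X ** (- Y) = - (X ** Y)" for X :: "'a::ring_1^'n^'m"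
  by (simp add: vec_eq_iff matrix_mult_component sum_negf)

lemma matrix_scaleR_left: "(r *\<^sub>R X) ** Y = r *\<^sub>R (X ** Y)" for X :: "complex^'n^'m"
  by (simp add: vec_eq_iff matrix_mult_component scaleR_sum_right)

lemma matrix_scaleR_right: "X ** (r *\<^sub>R Y) = r *\<^sub>R (X ** Y)" for X :: "complex^'n^'m"
  by (simp add: vec_eq_iff matrix_mult_component scaleR_sum_right)

lemmas matrix_distribs = matrix_add_ldistrib matrix_add_rdistrib matrix_diff_ldistrib
  matrix_diff_rdistrib matrix_minus_left matrix_minus_right matrix_scaleR_left matrix_scaleR_right

lemma transpose_add: "transpose (X + Y) = transpose X + transpose Y"
  by (simp add: vec_eq_iff transpose_component)

lemma transpose_diff: "transpose (X - Y) = transpose X - transpose Y"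
  by (simp add: vec_eq_iff transpose_component)

lemma transpose_minus: "transpose (- X) = - transpose X"
  by (simp add: vec_eq_iff transpose_component)

lemma cnj_mat_mult: "cnj_mat (X ** Y) = cnj_mat X ** cnj_mat Y"
  by (simp add: vec_eq_iff matrix_mult_component)

lemma cnj_mat_add: "cnj_mat (X + Y) = cnj_mat X + cnj_mat Y"
  by (simp add: vec_eq_iff)

lemma cnj_mat_diff: "cnj_mat (X - Y) = cnj_mat X - cnj_mat Y"
  by (simp add: vec_eq_iff)

lemma cnj_mat_minus: "cnj_mat (- X) = - cnj_mat X"
  by (simp add: vec_eq_iff)

lemma cnj_mat_scaleR: "cnj_mat (r *\<^sub>R X) = r *\<^sub>R cnj_mat X"
  by (simp add: vec_eq_iff)

lemma cnj_mat_cnj_mat: "cnj_mat (cnj_mat X) = X"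
  by (simp add: vec_eq_iff)

lemma transpose_cnj_mat: "transpose (cnj_mat X) = cnj_mat (transpose X)"
  by (simp add: vec_eq_iff transpose_component)

section \<open>Two by two blocks, and complex matrices as pairs of real ones\<close>

lemma sum_UNIV_Plus:
  "(\<Sum>i\<in>(UNIV :: ('a::finite + 'b::finite) set). f i)
   = (\<Sum>i\<in>UNIV. f (Inl i)) + (\<Sum>i\<in>UNIV. f (Inr i))"
  by (subst UNIV_Plus_UNIV[symmetric], subst sum.Plus) auto

lemma Plus_all_iff: "(\<forall>i. P i) \<longleftrightarrow> (\<forall>k. P (Inl k)) \<and> (\<forall>k. P (Inr k))"
  by (metis sum.exhaust)

lemma block_nth:
  "block P Q R S $ Inl k $ Inl l = P $ k $ l" "block P Q R S $ Inl k $ Inr l = Q $ k $ l"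
  "block P Q R S $ Inr k $ Inl l = R $ k $ l" "block P Q R S $ Inr k $ Inr l = S $ k $ l"
  by (simp_all add: block_def)

lemma cmat_nth: "cmat A B $ i $ j = Complex (A $ i $ j) (B $ i $ j)"
  by (simp add: cmat_def complex_eq_iff)

lemma cmat_mult: "cmat A B ** cmat A' B' = cmat (A ** A' - B ** B') (A ** B' + B ** A')"
  by (simp add: vec_eq_iff cmat_nth matrix_mult_component complex_eq_iff sum_subtractf sum.distrib)

lemma cmat_diff: "cmat A B - cmat A' B' = cmat (A - A') (B - B')"
  by (simp add: vec_eq_iff cmat_nth complex_eq_iff)

lemma cnj_mat_cmat: "cnj_mat (cmat A B) = cmat A (- B)"
  by (simp add: vec_eq_iff cmat_nth complex_eq_iff)

lemma transpose_cmat: "transpose (cmat A B) = cmat (transpose A) (transpose B)"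
  by (simp add: vec_eq_iff cmat_nth transpose_component)

lemma cmat_eq_iff: "cmat A B = cmat A' B' \<longleftrightarrow> A = A' \<and> B = B'"
  by (auto simp add: vec_eq_iff cmat_nth complex_eq_iff)

lemma cmat_eq_0_iff: "cmat A B = 0 \<longleftrightarrow> A = 0 \<and> B = 0"
  by (auto simp add: vec_eq_iff cmat_nth complex_eq_iff)

lemma cmat_add: "cmat A B + cmat A' B' = cmat (A + A') (B + B')"
  by (simp add: vec_eq_iff cmat_nth complex_eq_iff)

lemma cmat_surj: obtains A B where "M = cmat A B"
proof
  show "M = cmat (map_matrix Re M) (map_matrix Im M)"
    by (simp add: vec_eq_iff cmat_nth)
qed

lemma trace_cmat: "trace (cmat A B) = Complex (trace A) (trace B)"
  by (simp add: trace_component cmat_nth complex_eq_iff)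

lemma m_elt_nth:
  "m_elt A B $ Inl k $ Inl l = Complex 0 (A $ k $ l)"
  "m_elt A B $ Inl k $ Inr l = Complex 0 (B $ k $ l)"
  "m_elt A B $ Inr k $ Inl l = Complex 0 (B $ k $ l)"
  "m_elt A B $ Inr k $ Inr l = Complex 0 (- (A $ k $ l))"
  by (simp_all add: m_elt_def block_nth complex_eq_iff)

lemma h_elt_nth:
  "h_elt C D $ Inl k $ Inl l = Complex (C $ k $ l) 0"
  "h_elt C D $ Inl k $ Inr l = Complex (- (D $ k $ l)) 0"
  "h_elt C D $ Inr k $ Inl l = Complex (D $ k $ l) 0"
  "h_elt C D $ Inr k $ Inr l = Complex (C $ k $ l) 0"
  by (simp_all add: h_elt_def block_nth complex_eq_iff)

text \<open>With pairs of real vectors read as z in \<complex>^n, \<open>h_elt C D\<close> is the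
  real matrix of z -> (C + iD) z, and \<open>m_elt A B\<close> is i times the real matrix of z -> (A
  + iB) cnj z. The four product rules compose such maps; in this one the two factors i give the
  sign.\<close>

lemma m_elt_mult_m_elt:
  "m_elt A B ** m_elt A' B' = h_elt (- (A ** A' + B ** B')) (A ** B' - B ** A')"
  by (simp add: vec_eq_iff Plus_all_iff m_elt_nth h_elt_nth matrix_mult_component sum_UNIV_Plus
      complex_eq_iff sum_negf sum.distrib sum_subtractf algebra_simps)

lemma m_elt_mult_h_elt:
  "m_elt A B ** h_elt C D = m_elt (A ** C + B ** D) (B ** C - A ** D)"
  by (simp add: vec_eq_iff Plus_all_iff m_elt_nth h_elt_nth matrix_mult_component sum_UNIV_Plus
      complex_eq_iff sum_negf sum.distrib sum_subtractf algebra_simps)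

lemma h_elt_mult_m_elt:
  "h_elt C D ** m_elt A B = m_elt (C ** A - D ** B) (C ** B + D ** A)"
  by (simp add: vec_eq_iff Plus_all_iff m_elt_nth h_elt_nth matrix_mult_component sum_UNIV_Plus
      complex_eq_iff sum_negf sum.distrib sum_subtractf algebra_simps)

lemma h_elt_mult_h_elt:
  "h_elt C D ** h_elt C' D' = h_elt (C ** C' - D ** D') (D ** C' + C ** D')"
  by (simp add: vec_eq_iff Plus_all_iff m_elt_nth h_elt_nth matrix_mult_component sum_UNIV_Plus
      complex_eq_iff sum_negf sum.distrib sum_subtractf algebra_simps)

lemma m_elt_diff: "m_elt A B - m_elt A' B' = m_elt (A - A') (B - B')"
  by (simp add: vec_eq_iff Plus_all_iff m_elt_nth complex_eq_iff)

lemma h_elt_diff: "h_elt A B - h_elt A' B' = h_elt (A - A') (B - B')"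
  by (simp add: vec_eq_iff Plus_all_iff h_elt_nth complex_eq_iff)

lemma trace_h_elt: "trace (h_elt C D) = complex_of_real (2 * trace C)"
  by (simp add: trace_component sum_UNIV_Plus h_elt_nth complex_eq_iff)

section \<open>The symmetric Lie algebra\<close>

lemma theta_nth:
  "theta $ Inl k $ Inl l = 0" "theta $ Inl k $ Inr l = (if k = l then 1 else 0)"
  "theta $ Inr k $ Inl l = (if k = l then - 1 else 0)" "theta $ Inr k $ Inr l = 0"
  by (simp_all add: theta_def block_nth mat_def)

lemma theta_theta: "theta ** theta = - mat 1"
  by (simp add: vec_eq_iff Plus_all_iff theta_nth matrix_mult_component sum_UNIV_Plus mat_def
      mult_delta_left mult_delta_right)

lemma transpose_theta: "transpose theta = - theta"
  by (simp add: vec_eq_iff Plus_all_iff theta_nth transpose_component)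

lemma cnj_mat_theta: "cnj_mat theta = theta"
  by (simp add: vec_eq_iff Plus_all_iff theta_nth)

text \<open>Multiplying by \<open>theta\<close> on the right, with theta^2 = -1, exhibits
  \<open>sp_complex\<close> as the fixed space of the involution g -> theta g^t theta. Averaging
  over an involution is what later supplies a projection.\<close>

lemma sp_complex_iff: "g \<in> sp_complex \<longleftrightarrow> theta ** transpose g ** theta = g"
proof -
  have "g ** theta + theta ** transpose g = 0 \<longleftrightarrow> theta ** transpose g = - (g ** theta)"
    by (rule add_eq_0_iff)
  also have "\<dots> \<longleftrightarrow> theta ** transpose g ** theta = g"
  proof
    assume "theta ** transpose g = - (g ** theta)"
    then have "theta ** transpose g ** theta = - (g ** theta) ** theta"
      by simp
    then show "theta ** transpose g ** theta = g"
      by (simp add: matrix_distribs matrix_mul_assoc[symmetric] theta_theta)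
  next
    assume "theta ** transpose g ** theta = g"
    then have "g ** theta = theta ** transpose g ** theta ** theta"
      by simp
    then show "theta ** transpose g = - (g ** theta)"
      by (simp add: matrix_distribs matrix_mul_assoc[symmetric] theta_theta)
  qed
  finally show ?thesis
    by (simp add: sp_complex_def)
qed

lemma sp_iff: "g \<in> sp \<longleftrightarrow> g \<in> sp_complex \<and> transpose g = - cnj_mat g"
  by (simp add: sp_def sp_complex_def)

lemma sp_complex_transpose:
  assumes "g \<in> sp_complex"
  shows "theta ** g ** theta = transpose g"
proof -
  have "transpose (theta ** transpose g ** theta) = transpose g"
    using assms by (simp add: sp_complex_iff)
  then show ?thesis
    by (simp add: matrix_transpose_mul transpose_theta matrix_distribs matrix_mul_assoc)
qed

text \<open>Conjugate the identity theta g theta = g^t, using that \<open>theta\<close> is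
  real.\<close>

lemma sp_complex_transpose_cnj:
  assumes "g \<in> sp_complex"
  shows "transpose (cnj_mat g) \<in> sp_complex"
proof -
  have "cnj_mat (theta ** g ** theta) = cnj_mat (transpose g)"
    using sp_complex_transpose[OF assms] by simp
  then show ?thesis
    by (simp add: sp_complex_iff cnj_mat_mult cnj_mat_theta transpose_cnj_mat)
qed

lemma subspace_sp_complex: "subspace sp_complex"
proof (rule subspaceI)
  show "0 \<in> sp_complex"
    by (simp add: sp_complex_iff vec_eq_iff matrix_mult_component transpose_component)
qed (simp_all add: sp_complex_iff transpose_add transpose_scalar matrix_distribs)

lemma subspace_sp: "subspace sp"
proof (rule subspaceI)
  show "0 \<in> sp"
    using subspace_0[OF subspace_sp_complex] by (simp add: sp_iff vec_eq_iff transpose_component)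
  show "X + Y \<in> sp" if "X \<in> sp" "Y \<in> sp" for X Y :: "complex^('n::finite + 'n)^('n + 'n)"
    using that subspace_add[OF subspace_sp_complex, of X Y]
    by (simp add: sp_iff transpose_add cnj_mat_add)
  show "c *\<^sub>R X \<in> sp" if "X \<in> sp" for X :: "complex^('n::finite + 'n)^('n + 'n)" and c
    using that subspace_scale[OF subspace_sp_complex, of X c]
    by (simp add: sp_iff transpose_scalar cnj_mat_scaleR)
qed

lemma subspace_sp_h: "subspace sp_h"
proof (rule subspaceI)
  show "0 \<in> sp_h"
    using subspace_0[OF subspace_sp] by (simp add: sp_h_def vec_eq_iff)
qed (simp_all add: sp_h_def cnj_mat_add cnj_mat_scaleR subspace_add[OF subspace_sp]
    subspace_scale[OF subspace_sp])

lemma subspace_sp_m: "subspace sp_m"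
proof (rule subspaceI)
  show "0 \<in> sp_m"
    using subspace_0[OF subspace_sp] by (simp add: sp_m_def vec_eq_iff)
qed (simp_all add: sp_m_def cnj_mat_add cnj_mat_scaleR subspace_add[OF subspace_sp]
    subspace_scale[OF subspace_sp])

section \<open>Closure under brackets and the symmetric decomposition\<close>

lemma bracket_sp_complex:
  assumes "X \<in> sp_complex" "Y \<in> sp_complex"
  shows "bracket X Y \<in> sp_complex"
proof -
  \<comment> \<open>The involution reverses products, and theta^2 = -1 adds a sign; the two effects
    cancel on commutators.\<close>
  have *: "theta ** transpose (X ** Y) ** theta = - (Y ** X)"
    if "X \<in> sp_complex" "Y \<in> sp_complex" for X Y :: "complex^('n::finite + 'n)^('n + 'n)"
  proof -
    have "Y ** X = (theta ** transpose Y ** theta) ** (theta ** transpose X ** theta)"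
      using that by (simp add: sp_complex_iff)
    also have "\<dots> = theta ** transpose Y ** (theta ** theta) ** transpose X ** theta"
      by (simp add: matrix_mul_assoc)
    finally show ?thesis
      by (simp add: theta_theta matrix_distribs matrix_transpose_mul matrix_mul_assoc)
  qed
  show ?thesis
    using *[of X Y] *[of Y X] assms
    by (subst sp_complex_iff) (simp add: bracket_def transpose_diff matrix_distribs)
qed

lemma bracket_sp:
  assumes "X \<in> sp" "Y \<in> sp"
  shows "bracket X Y \<in> sp"
  using assms bracket_sp_complex[of X Y]
  by (simp add: sp_iff bracket_def transpose_diff matrix_transpose_mul cnj_mat_diff cnj_mat_mult
      matrix_distribs)

text \<open>Conjugation is an automorphism of the bracket, so its eigenvalues 1 and -1 multiply. The
  three inclusions that follow come from this.\<close>

lemma cnj_mat_bracket: "cnj_mat (bracket X Y) = bracket (cnj_mat X) (cnj_mat Y)"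
  by (simp add: bracket_def cnj_mat_diff cnj_mat_mult)

lemma bracket_m_m: "X \<in> sp_m \<Longrightarrow> Y \<in> sp_m \<Longrightarrow> bracket X Y \<in> sp_h"
  by (simp add: sp_m_def sp_h_def bracket_sp cnj_mat_bracket)
    (simp add: bracket_def matrix_distribs)

lemma bracket_m_h: "X \<in> sp_m \<Longrightarrow> Y \<in> sp_h \<Longrightarrow> bracket X Y \<in> sp_m"
  by (simp add: sp_m_def sp_h_def bracket_sp cnj_mat_bracket)
    (simp add: bracket_def matrix_distribs)

lemma bracket_h_h: "X \<in> sp_h \<Longrightarrow> Y \<in> sp_h \<Longrightarrow> bracket X Y \<in> sp_h"
  by (simp add: sp_h_def bracket_sp cnj_mat_bracket)

text \<open>Since (cnj X)^t = -X on \<open>sp\<close>, the identity theta X theta = X^t becomes cnj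
  X = theta (cnj X)^t theta, which is the membership test for cnj X.\<close>

lemma sp_cnj_mat:
  assumes "X \<in> sp"
  shows "cnj_mat X \<in> sp"
proof -
  have "cnj_mat X = (- 1) *\<^sub>R transpose X" and t: "transpose X = - cnj_mat X"
    using assms by (simp_all add: sp_iff)
  moreover have "transpose (cnj_mat X) \<in> sp_complex"
    using assms by (simp add: sp_iff sp_complex_transpose_cnj)
  ultimately have "X \<in> sp_complex" "cnj_mat X = theta ** transpose (cnj_mat X) ** theta"
    using assms sp_complex_transpose[of X]
    by (simp_all add: sp_iff transpose_cnj_mat cnj_mat_minus cnj_mat_cnj_mat matrix_distribs)
  then have "cnj_mat X \<in> sp_complex"
    by (simp add: sp_complex_iff)
  then show ?thesis
    using t by (simp add: sp_iff transpose_cnj_mat cnj_mat_minus)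
qed

lemma sp_decomposition: "sp = {X + Y | X Y. X \<in> sp_h \<and> Y \<in> sp_m}"
proof (intro equalityI subsetI)
  fix g :: "complex^('n::finite + 'n)^('n + 'n)"
  assume g: "g \<in> sp"
  define X Y where "X = (1/2) *\<^sub>R (g + cnj_mat g)" and "Y = (1/2) *\<^sub>R (g - cnj_mat g)"
  have "X \<in> sp" "Y \<in> sp"
    using g sp_cnj_mat[OF g] unfolding X_def Y_def
    by (simp_all add: subspace_sp subspace_scale subspace_add subspace_diff)
  then have "X \<in> sp_h" "Y \<in> sp_m"
    by (simp_all add: sp_h_def sp_m_def X_def Y_def cnj_mat_scaleR cnj_mat_add cnj_mat_diff
        cnj_mat_cnj_mat scaleR_right_diff_distrib scaleR_right_distrib)
  moreover have "g = X + Y"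
    by (simp add: X_def Y_def vec_eq_iff complex_eq_iff)
  ultimately show "g \<in> {X + Y | X Y. X \<in> sp_h \<and> Y \<in> sp_m}"
    by blast
qed (auto simp: sp_h_def sp_m_def intro: subspace_add[OF subspace_sp])

lemma sp_h_inter_sp_m: "sp_h \<inter> sp_m = {0}"
proof -
  have "X = 0" if "X \<in> sp_h" "X \<in> sp_m" for X :: "complex^('n::finite + 'n)^('n + 'n)"
  proof -
    have "X = - X"
      using that by (simp add: sp_h_def sp_m_def)
    then show ?thesis
      by (simp add: vec_eq_iff)
  qed
  then show ?thesis
    using subspace_0[OF subspace_sp_h] subspace_0[OF subspace_sp_m] by blast
qed

section \<open>Block form of the two eigenspaces\<close>

lemma theta_conj_nth:
  "(theta ** Y ** theta) $ Inl k $ Inl l = - Y $ Inr k $ Inr l"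
  "(theta ** Y ** theta) $ Inl k $ Inr l = Y $ Inr k $ Inl l"
  "(theta ** Y ** theta) $ Inr k $ Inl l = Y $ Inl k $ Inr l"
  "(theta ** Y ** theta) $ Inr k $ Inr l = - Y $ Inl k $ Inl l"
  by (simp_all add: theta_nth matrix_mult_component sum_UNIV_Plus
      mult_delta_left mult_delta_right sum_negf)

lemma sp_complex_iff_components:
  "g \<in> sp_complex \<longleftrightarrow>
     (\<forall>k l. g $ Inr k $ Inr l = - g $ Inl l $ Inl k \<and>
        g $ Inl k $ Inr l = g $ Inl l $ Inr k \<and> g $ Inr k $ Inl l = g $ Inr l $ Inl k)"
  unfolding sp_complex_iff vec_eq_iff
  by (simp add: Plus_all_iff theta_conj_nth transpose_component) (metis minus_minus)

lemma m_elt_in_sp_m: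
  assumes "transpose A = A" "transpose B = B"
  shows "m_elt A B \<in> sp_m"
proof -
  have "A $ k $ l = A $ l $ k" "B $ k $ l = B $ l $ k" for k l
    using assms by (metis transpose_component)+
  then show ?thesis
    by (simp add: sp_m_def sp_iff sp_complex_iff_components vec_eq_iff Plus_all_iff m_elt_nth
        transpose_component complex_eq_iff)
qed

lemma h_elt_in_sp_h:
  assumes "transpose C = - C" "transpose D = D"
  shows "h_elt C D \<in> sp_h"
proof -
  have "- C $ l $ k = C $ k $ l" "D $ k $ l = D $ l $ k" for k l
    using assms by (metis transpose_component vector_uminus_component)+
  then show ?thesis
    by (simp add: sp_h_def sp_iff sp_complex_iff_components vec_eq_iff Plus_all_iff h_elt_nth
        transpose_component complex_eq_iff)
qed

lemma sp_mE:
  assumes "X \<in> sp_m"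
  obtains A B where "X = m_elt A B" "transpose A = A" "transpose B = B"
proof -
  define A B where "A = (\<chi> k l. Im (X $ Inl k $ Inl l))" and "B = (\<chi> k l. Im (X $ Inl k $ Inr l))"
  \<comment> \<open>Conjugation negates X, so the skew-hermitian condition makes X symmetric and
    purely imaginary.\<close>
  have X: "X \<in> sp_complex" "transpose X = X" and Re: "Re (X $ i $ j) = 0" for i j
    using assms by (auto simp add: sp_m_def sp_iff vec_eq_iff complex_eq_iff)
  have sym: "X $ i $ j = X $ j $ i" for i j
    using X(2) by (metis transpose_component)
  have rl: "X $ Inr k $ Inl l = X $ Inl k $ Inr l" for k l
    using X(1) sym[of "Inr k" "Inl l"] by (simp add: sp_complex_iff_components)
  have rr: "X $ Inr k $ Inr l = - X $ Inl k $ Inl l" for k l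
    using X(1) sym[of "Inl k" "Inl l"] by (simp add: sp_complex_iff_components)
  show ?thesis
  proof
    show "X = m_elt A B"
      by (simp add: vec_eq_iff Plus_all_iff m_elt_nth A_def B_def complex_eq_iff rl rr Re)
    show "transpose A = A"
      using sym by (simp add: vec_eq_iff transpose_component A_def)
    have "B $ l $ k = B $ k $ l" for k l
      using X(1) by (simp add: B_def sp_complex_iff_components)
    then show "transpose B = B"
      by (simp add: vec_eq_iff transpose_component)
  qed
qed

lemma sp_hE:
  assumes "X \<in> sp_h"
  obtains C D where "X = h_elt C D" "transpose C = - C" "transpose D = D"
proof -
  define C D where "C = (\<chi> k l. Re (X $ Inl k $ Inl l))" and "D = (\<chi> k l. Re (X $ Inr k $ Inl l))"
  have X: "X \<in> sp_complex" "transpose X = - X" and Im: "Im (X $ i $ j) = 0" for i j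
    using assms by (auto simp add: sp_h_def sp_iff vec_eq_iff complex_eq_iff)
  have skew: "X $ i $ j = - X $ j $ i" for i j
    using X(2) by (metis transpose_component vector_uminus_component)
  have lr: "X $ Inl k $ Inr l = - X $ Inr k $ Inl l" for k l
    using X(1) skew[of "Inl l" "Inr k"] by (simp add: sp_complex_iff_components)
  have rr: "X $ Inr k $ Inr l = X $ Inl k $ Inl l" for k l
    using X(1) skew[of "Inl k" "Inl l"] by (simp add: sp_complex_iff_components)
  show ?thesis
  proof
    show "X = h_elt C D"
      by (simp add: vec_eq_iff Plus_all_iff h_elt_nth C_def D_def complex_eq_iff lr rr Im)
    have "C $ l $ k = - C $ k $ l" for k l
      using skew[of "Inl l" "Inl k"] by (simp add: C_def)
    then show "transpose C = - C"
      unfolding vec_eq_iff transpose_component vector_uminus_component by blast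
    have "D $ l $ k = D $ k $ l" for k l
      using X(1) by (simp add: D_def sp_complex_iff_components)
    then show "transpose D = D"
      by (simp add: vec_eq_iff transpose_component)
  qed
qed

lemma sp_m_eq: "sp_m = {m_elt A B | A B. transpose A = A \<and> transpose B = B}"
  by (auto simp: m_elt_in_sp_m) (metis sp_mE)

lemma sp_h_eq: "sp_h = {h_elt C D | C D. transpose C = - C \<and> transpose D = D}"
  by (auto simp: h_elt_in_sp_h) (metis sp_hE)

section \<open>The identifications with complex n by n matrices\<close>

lemma linear_m_id: "linear m_id"
  by (rule linearI) (simp_all add: m_id_def vec_eq_iff cmat_nth complex_eq_iff)

lemma linear_h_id: "linear h_id"
  by (rule linearI) (simp_all add: h_id_def vec_eq_iff cmat_nth complex_eq_iff)

lemma bij_betw_m_id: "bij_betw m_id sp_m {M. transpose M = M}"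
proof (rule bij_betw_imageI)
  show "inj_on m_id sp_m"
    by (auto intro!: inj_onI elim!: sp_mE simp: m_id_m_elt cmat_eq_iff)
  show "m_id ` sp_m = {M. transpose M = M}"
  proof (intro equalityI subsetI)
    fix M :: "complex^'n^'n"
    assume M: "M \<in> {M. transpose M = M}"
    obtain A B where "M = cmat A B"
      by (rule cmat_surj)
    with M show "M \<in> m_id ` sp_m"
      by (intro image_eqI[of _ _ "m_elt A B"])
        (simp_all add: m_id_m_elt m_elt_in_sp_m transpose_cmat cmat_eq_iff)
  qed (auto elim!: sp_mE simp: m_id_m_elt transpose_cmat)
qed

lemma bij_betw_h_id: "bij_betw h_id sp_h {M. transpose (cnj_mat M) + M = 0}"
proof (rule bij_betw_imageI)
  have *: "transpose (cnj_mat (cmat C D)) + cmat C D = 0 \<longleftrightarrow> transpose C = - C \<and> transpose D = D"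
    for C D :: "real^'n^'n"
    by (simp add: cnj_mat_cmat transpose_cmat cmat_add cmat_eq_0_iff transpose_minus add_eq_0_iff2
        eq_commute[of D])
  show "inj_on h_id sp_h"
    by (auto intro!: inj_onI elim!: sp_hE simp: h_id_h_elt cmat_eq_iff)
  show "h_id ` sp_h = {M. transpose (cnj_mat M) + M = 0}"
  proof (intro equalityI subsetI)
    fix M :: "complex^'n^'n"
    assume M: "M \<in> {M. transpose (cnj_mat M) + M = 0}"
    obtain C D where "M = cmat C D"
      by (rule cmat_surj)
    with M show "M \<in> h_id ` sp_h"
      by (intro image_eqI[of _ _ "h_elt C D"]) (simp_all add: h_id_h_elt h_elt_in_sp_h *)
  qed (auto elim!: sp_hE simp: h_id_h_elt *)
qed

lemma m_id_sym: "X \<in> sp_m \<Longrightarrow> transpose (m_id X) = m_id X"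
  using bij_betwE[OF bij_betw_m_id] by blast

lemma lie_subalgebra_sp_h: "lie_subalgebra sp_h sp"
  by (auto simp: lie_subalgebra_def subspace_sp_h bracket_h_h) (simp add: sp_h_def)

section \<open>Brackets and the trace form under the identifications\<close>

lemma h_id_bracket_m_m:
  assumes "X \<in> sp_m" "Y \<in> sp_m"
  shows "h_id (bracket X Y) = m_id Y ** cnj_mat (m_id X) - m_id X ** cnj_mat (m_id Y)"
proof -
  obtain A B where X: "X = m_elt A B"
    using assms(1) by (blast elim: sp_mE)
  obtain A' B' where Y: "Y = m_elt A' B'"
    using assms(2) by (blast elim: sp_mE)
  show ?thesis
    by (simp add: X Y bracket_def m_elt_mult_m_elt h_elt_diff h_id_h_elt m_id_m_elt
        cnj_mat_cmat cmat_mult cmat_diff cmat_eq_iff matrix_distribs)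
qed

lemma m_id_bracket_m_h:
  assumes "X \<in> sp_m" "Y \<in> sp_h"
  shows "m_id (bracket X Y) = m_id X ** cnj_mat (h_id Y) - h_id Y ** m_id X"
proof -
  obtain A B where X: "X = m_elt A B"
    using assms(1) by (blast elim: sp_mE)
  obtain C D where Y: "Y = h_elt C D"
    using assms(2) by (blast elim: sp_hE)
  show ?thesis
    by (simp add: X Y bracket_def m_elt_mult_h_elt h_elt_mult_m_elt m_elt_diff
        h_id_h_elt m_id_m_elt cnj_mat_cmat cmat_mult cmat_diff cmat_eq_iff matrix_distribs)
qed

lemma h_id_bracket_h_h:
  assumes "X \<in> sp_h" "Y \<in> sp_h"
  shows "h_id (bracket X Y) = h_id X ** h_id Y - h_id Y ** h_id X"
proof -
  obtain C D where X: "X = h_elt C D"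
    using assms(1) by (blast elim: sp_hE)
  obtain C' D' where Y: "Y = h_elt C' D'"
    using assms(2) by (blast elim: sp_hE)
  show ?thesis
    by (simp add: X Y bracket_def h_elt_mult_h_elt h_elt_diff h_id_h_elt
        cmat_mult cmat_diff cmat_eq_iff matrix_distribs)
qed

text \<open>The two diagonal blocks of the product have the same trace, which gives the 2; the
  square of i gives the sign.\<close>

lemma trace_mult_sp_m:
  assumes "X \<in> sp_m" "Y \<in> sp_m"
  shows "Re (trace (X ** Y)) = - 2 * Re (trace (m_id X ** cnj_mat (m_id Y)))"
proof -
  obtain A B where X: "X = m_elt A B"
    using assms(1) by (blast elim: sp_mE)
  obtain A' B' where Y: "Y = m_elt A' B'"
    using assms(2) by (blast elim: sp_mE)
  show ?thesis
    by (simp add: X Y m_elt_mult_m_elt trace_h_elt m_id_m_elt cnj_mat_cmat cmat_mult trace_cmat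
        matrix_distribs trace_add trace_sub trace_minus)
qed

text \<open>The bracket lies in \<open>sp_h\<close>, where \<open>h_id\<close> is injective. All
  later questions about abelian subspaces of \<open>sp_m\<close> are settled through this
  relation.\<close>

lemma bracket_m_m_eq_0_iff:
  assumes "X \<in> sp_m" "Y \<in> sp_m"
  shows "bracket X Y = 0 \<longleftrightarrow> m_id Y ** cnj_mat (m_id X) = m_id X ** cnj_mat (m_id Y)"
proof -
  have "bracket X Y = 0 \<longleftrightarrow> h_id (bracket X Y) = h_id 0"
    by (rule inj_on_eq_iff[OF bij_betw_imp_inj_on[OF bij_betw_h_id], symmetric])
      (rule bracket_m_m[OF assms], rule subspace_0[OF subspace_sp_h])
  then show ?thesis
    by (simp add: h_id_bracket_m_m[OF assms] linear_0[OF linear_h_id])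
qed

section \<open>Traces\<close>

text \<open>Expand f (P b) in the basis E. Summing over b first rebuilds e from its coordinates e
  \<bullet> b, so the coefficient functional \<open>c e\<close> is evaluated at e itself, where P is
  the identity.\<close>

lemma trace_on_eq_sum_Basis:
  fixes f P :: "'v::euclidean_space \<Rightarrow> 'v"
  assumes V: "subspace V" and f: "linear f" "\<And>v. v \<in> V \<Longrightarrow> f v \<in> V"
    and P: "linear P" "\<And>v. P v \<in> V" "\<And>v. v \<in> V \<Longrightarrow> P v = v"
  shows "trace_on V f = (\<Sum>b\<in>Basis. f (P b) \<bullet> b)"
proof -
  \<comment> \<open>The same choice as inside \<open>trace_on\<close>, so no comparison of bases
    arises.\<close>
  define E where "E = (SOME E. E \<subseteq> V \<and> independent E \<and> span E = V)"
  have "\<exists>E. E \<subseteq> V \<and> independent E \<and> span E = V"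
    by (metis basis_exists V span_minimal subset_antisym)
  then have "E \<subseteq> V \<and> independent E \<and> span E = V"
    unfolding E_def by (rule someI_ex)
  then have E: "E \<subseteq> V" "independent E" "span E = V"
    by auto
  define c where "c e v = representation E (f (P v)) e" for e v
  have lin: "linear (c e)" for e
    unfolding c_def using E f P
    by (intro linearI)
      (simp_all add: linear_add[OF f(1)] linear_add[OF P(1)] linear_scale[OF f(1)]
        linear_scale[OF P(1)] representation_add representation_scale)
  have "(\<Sum>b\<in>Basis. f (P b) \<bullet> b) = (\<Sum>b\<in>Basis. (\<Sum>e\<in>E. c e b *\<^sub>R e) \<bullet> b)"
    unfolding c_def using E f P
    by (intro sum.cong refl) (simp add: sum_representation_eq finiteI_independent)
  also have "\<dots> = (\<Sum>e\<in>E. \<Sum>b\<in>Basis. (e \<bullet> b) * c e b)"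
    by (simp add: inner_sum_left mult.commute) (rule sum.swap)
  also have "\<dots> = (\<Sum>e\<in>E. c e (\<Sum>b\<in>Basis. (e \<bullet> b) *\<^sub>R b))"
    by (simp add: linear_sum[OF lin] linear_scale[OF lin])
  also have "\<dots> = (\<Sum>e\<in>E. representation E (f e) e)"
    using E(1) P(3) by (intro sum.cong refl) (auto simp: euclidean_representation c_def)
  finally show ?thesis
    by (simp add: trace_on_def E_def Let_def)
qed

lemma trace_on_id:
  assumes "subspace V"
  shows "trace_on V (\<lambda>v. v) = real (dim V)"
proof -
  define E where "E = (SOME E. E \<subseteq> V \<and> independent E \<and> span E = V)"
  have "\<exists>E. E \<subseteq> V \<and> independent E \<and> span E = V"
    by (metis basis_exists assms span_minimal subset_antisym)
  then have "E \<subseteq> V \<and> independent E \<and> span E = V"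
    unfolding E_def by (rule someI_ex)
  then show ?thesis
    by (auto simp: trace_on_def E_def[symmetric] representation_basis dim_eq_card_independent)
qed

lemma dim_eq_trace_of_projection:
  fixes P :: "'v::euclidean_space \<Rightarrow> 'v"
  assumes "subspace V" "linear P" "\<And>v. P v \<in> V" "\<And>v. v \<in> V \<Longrightarrow> P v = v"
  shows "real (dim V) = (\<Sum>b\<in>Basis. P b \<bullet> b)"
  using trace_on_eq_sum_Basis[of V "\<lambda>v. v" P] assms
  by (simp add: trace_on_id linear_id[unfolded id_def])

section \<open>Real traces of maps on complex matrices, by matrix units\<close>

abbreviation unit_mat :: "'k \<Rightarrow> 'k \<Rightarrow> complex \<Rightarrow> complex^'k^'k" where
  "unit_mat i j z \<equiv> axis i (axis j z)"

lemma sum_Basis_vec: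
  "(\<Sum>b\<in>(Basis :: ('a::euclidean_space^'k) set). f b) = (\<Sum>i\<in>UNIV. \<Sum>u\<in>Basis. f (axis i u))"
proof -
  have B: "(Basis :: ('a^'k) set) = (\<lambda>(i, u). axis i u) ` (UNIV \<times> Basis)"
    by (auto simp: Basis_vec_def)
  have "inj_on (\<lambda>(i::'k, u::'a). axis i u) (UNIV \<times> Basis)"
    by (auto intro!: inj_onI simp: axis_eq_axis nonzero_Basis)
  then have "sum f Basis = (\<Sum>(i, u)\<in>UNIV \<times> Basis. f (axis i u))"
    unfolding B by (simp only: sum.reindex o_def case_prod_unfold)
  then show ?thesis
    by (simp add: sum.cartesian_product)
qed

lemma sum_Basis_cmat:
  "(\<Sum>b\<in>(Basis :: (complex^'k^'k) set). A b \<bullet> b)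
   = (\<Sum>i\<in>UNIV. \<Sum>j\<in>UNIV. Re (A (unit_mat i j 1) $ i $ j) + Im (A (unit_mat i j \<i>) $ i $ j))"
  by (simp add: sum_Basis_vec Basis_complex_def inner_axis inner_complex_def)

abbreviation smult_mat :: "complex \<Rightarrow> complex^'k^'k \<Rightarrow> complex^'k^'k" where
  "smult_mat z M \<equiv> map_matrix ((*) z) M"

lemma smult_unit_mat: "smult_mat z (unit_mat i j 1) = unit_mat i j z"
  by (simp add: vec_eq_iff axis_def)

text \<open>If a is the complex diagonal coefficient at E_ij, the real basis vectors E_ij and i E_ij
  contribute Re a and Im (i a) = Re a. The real trace is thus twice the real part of the complex
  one.\<close>

lemma sum_Basis_complex_linear:
  assumes "\<And>M. A (smult_mat \<i> M) = smult_mat \<i> (A M)"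
  shows "(\<Sum>b\<in>(Basis :: (complex^'k^'k) set). A b \<bullet> b)
    = 2 * Re (\<Sum>i\<in>UNIV. \<Sum>j\<in>UNIV. A (unit_mat i j 1) $ i $ j)"
proof -
  have "A (unit_mat i j \<i>) = smult_mat \<i> (A (unit_mat i j 1))" for i j
    using assms[of "unit_mat i j 1"] by (simp add: smult_unit_mat)
  then show ?thesis
    by (simp add: sum_Basis_cmat sum_distrib_left)
qed

text \<open>Here i E_ij contributes Im (-i a) = -Re a, which cancels the contribution of
  E_ij.\<close>

lemma sum_Basis_complex_antilinear:
  assumes "\<And>M. A (smult_mat \<i> M) = - smult_mat \<i> (A M)"
  shows "(\<Sum>b\<in>(Basis :: (complex^'k^'k) set). A b \<bullet> b) = 0"
proof -
  have "A (unit_mat i j \<i>) = - smult_mat \<i> (A (unit_mat i j 1))" for i j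
    using assms[of "unit_mat i j 1"] by (simp add: smult_unit_mat)
  then show ?thesis
    by (simp add: sum_Basis_cmat)
qed

lemma unit_mat_nth: "unit_mat i j z $ k $ l = (if k = i \<and> l = j then z else 0)"
  by (simp add: axis_def)

lemma unit_mat_mult_nth: "(M ** unit_mat i j 1 ** N) $ k $ l = M $ k $ i * N $ j $ l"
proof -
  have "(M ** unit_mat i j 1) $ k $ m = (if m = j then M $ k $ i else 0)" for m
    by (cases "m = j") (simp_all add: matrix_mult_component unit_mat_nth mult_delta_right)
  then show ?thesis
    by (simp add: matrix_mult_component[of "M ** _"] mult_delta_left)
qed

lemma transpose_unit_mat: "transpose (unit_mat i j z) = unit_mat j i z"
  by (auto simp add: vec_eq_iff axis_def transpose_component)

text \<open>The left side is the complex trace of Z -> M Z N, that is, of the tensor product of M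
  and N^t.\<close>

lemma trace_mult_both:
  "(\<Sum>i\<in>UNIV. \<Sum>j\<in>UNIV. (M ** unit_mat i j 1 ** N) $ i $ j) = trace M * trace N"
  by (simp add: unit_mat_mult_nth trace_component sum_product)

text \<open>Transposition swaps E_ij and E_ji, so entries of M and N at the same position meet and a
  single trace replaces the product of two.\<close>

lemma trace_mult_both_transpose:
  "(\<Sum>i\<in>UNIV. \<Sum>j\<in>UNIV. (M ** transpose (unit_mat i j 1) ** N) $ i $ j) = trace (transpose M ** N)"
proof -
  have "(\<Sum>i\<in>UNIV. \<Sum>j\<in>UNIV. (M ** transpose (unit_mat i j 1) ** N) $ i $ j)
    = (\<Sum>i\<in>UNIV. \<Sum>j\<in>UNIV. M $ i $ j * N $ i $ j)"
    by (simp add: transpose_unit_mat unit_mat_mult_nth)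
  also have "\<dots> = (\<Sum>j\<in>UNIV. \<Sum>i\<in>UNIV. M $ i $ j * N $ i $ j)"
    by (rule sum.swap)
  finally show ?thesis
    by (simp add: trace_component matrix_mult_component transpose_component)
qed

section \<open>The Killing form\<close>

definition proj_sp_complex ::
  "complex^('n::finite + 'n)^('n + 'n) \<Rightarrow> complex^('n::finite + 'n)^('n + 'n)" where
  "proj_sp_complex g = (1/2) *\<^sub>R (g + theta ** transpose g ** theta)"

text \<open>A second average, over the antilinear involution Z -> -(cnj Z)^t of
  \<open>sp_complex\<close>, whose fixed points are \<open>sp\<close>.\<close>

definition proj_sp ::
  "complex^('n::finite + 'n)^('n + 'n) \<Rightarrow> complex^('n::finite + 'n)^('n + 'n)" where
  "proj_sp g = (1/2) *\<^sub>R (proj_sp_complex g - transpose (cnj_mat (proj_sp_complex g)))"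

lemma linear_proj_sp_complex: "linear proj_sp_complex"
  by (rule linearI) (simp_all add: proj_sp_complex_def transpose_add transpose_scalar
      matrix_distribs scaleR_right_distrib)

lemma linear_proj_sp: "linear proj_sp"
proof (rule linearI)
  note lin = linear_add[OF linear_proj_sp_complex] linear_scale[OF linear_proj_sp_complex]
  show "proj_sp (X + Y) = proj_sp X + proj_sp Y" for X Y
    by (simp add: proj_sp_def lin cnj_mat_add transpose_add scaleR_right_distrib
        scaleR_right_diff_distrib)
  show "proj_sp (r *\<^sub>R X) = r *\<^sub>R proj_sp X" for r X
    by (simp add: proj_sp_def lin cnj_mat_scaleR transpose_scalar scaleR_right_diff_distrib)
qed

lemma theta_conj_theta_conj: "theta ** (theta ** g ** theta) ** theta = g"
proof -
  have "theta ** (theta ** g ** theta) ** theta = (theta ** theta) ** g ** (theta ** theta)"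
    by (simp add: matrix_mul_assoc)
  then show ?thesis
    by (simp add: theta_theta matrix_distribs)
qed

lemma proj_sp_complex_in: "proj_sp_complex g \<in> sp_complex"
proof -
  have "transpose (theta ** transpose g ** theta) = theta ** g ** theta"
    by (simp add: matrix_transpose_mul transpose_theta matrix_distribs matrix_mul_assoc)
  then show ?thesis
    by (simp add: sp_complex_iff proj_sp_complex_def transpose_add transpose_scalar matrix_distribs
        theta_conj_theta_conj add.commute)
qed

lemma proj_sp_complex_id: "g \<in> sp_complex \<Longrightarrow> proj_sp_complex g = g"
  by (simp add: sp_complex_iff proj_sp_complex_def)

lemma proj_sp_in: "proj_sp g \<in> sp"
  unfolding sp_iff
proof
  show "proj_sp g \<in> sp_complex"
    unfolding proj_sp_def
    by (intro subspace_scale[OF subspace_sp_complex] subspace_diff[OF subspace_sp_complex]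
        sp_complex_transpose_cnj proj_sp_complex_in)
  show "transpose (proj_sp g) = - cnj_mat (proj_sp g)"
    by (simp add: proj_sp_def transpose_scalar transpose_diff cnj_mat_scaleR cnj_mat_diff
        transpose_cnj_mat cnj_mat_cnj_mat scaleR_right_diff_distrib)
qed

lemma proj_sp_id: "g \<in> sp \<Longrightarrow> proj_sp g = g"
  by (simp add: sp_iff proj_sp_def proj_sp_complex_id transpose_cnj_mat cnj_mat_minus cnj_mat_cnj_mat)

section \<open>The trace of ad X composed with ad Y\<close>

definition ad_ad where
  "ad_ad X Y Z = bracket X (bracket Y Z)"

lemma ad_ad_expand: "ad_ad X Y Z = X ** Y ** Z - X ** Z ** Y - Y ** Z ** X + Z ** (Y ** X)"
  by (simp add: ad_ad_def bracket_def matrix_distribs matrix_mul_assoc)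

lemma linear_ad_ad: "linear (ad_ad X Y)"
  by (rule linearI) (simp_all add: ad_ad_def bracket_def matrix_distribs scaleR_right_diff_distrib)

lemma smult_mat_mult: "smult_mat z M ** N = smult_mat z (M ** N)" "M ** smult_mat z N = smult_mat z (M ** N)"
  by (simp_all add: vec_eq_iff matrix_mult_component sum_distrib_left mult.left_commute mult.assoc)

lemma smult_mat_add: "smult_mat z (M + N) = smult_mat z M + smult_mat z N"
  "smult_mat z (M - N) = smult_mat z M - smult_mat z N"
  "smult_mat z (r *\<^sub>R M) = r *\<^sub>R smult_mat z M"
  "transpose (smult_mat z M) = smult_mat z (transpose M)"
  "cnj_mat (smult_mat z M) = smult_mat (cnj z) (cnj_mat M)"
  by (simp_all add: vec_eq_iff transpose_component algebra_simps)

lemma smult_ad_ad: "ad_ad X Y (smult_mat z Z) = smult_mat z (ad_ad X Y Z)"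
  by (simp add: ad_ad_def bracket_def smult_mat_mult smult_mat_add matrix_distribs)

lemma smult_proj_sp_complex: "proj_sp_complex (smult_mat z Z) = smult_mat z (proj_sp_complex Z)"
  by (simp add: proj_sp_complex_def smult_mat_mult smult_mat_add)

lemma trace_sp_complex:
  assumes "X \<in> sp_complex"
  shows "trace X = 0"
proof -
  have "X $ Inr k $ Inr k = - X $ Inl k $ Inl k" for k
    using assms by (simp add: sp_complex_iff_components)
  then show ?thesis
    by (simp add: trace_component sum_UNIV_Plus sum_negf)
qed

text \<open>The projection is half of Z plus half of theta Z^t theta. The first part yields 4 n tr
  (X Y), the second 4 tr (X Y), and half of the sum is 2 (n + 1) tr (X Y).\<close>

lemma trace_ad_ad_proj:
  fixes X Y :: "complex^('n::finite + 'n)^('n + 'n)"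
  assumes "X \<in> sp_complex" "Y \<in> sp_complex"
  shows "(\<Sum>i\<in>UNIV. \<Sum>j\<in>UNIV. ad_ad X Y (proj_sp_complex (unit_mat i j 1)) $ i $ j)
    = 2 * (of_nat CARD('n) + 1) * trace (X ** Y)"
proof -
  let ?u = "\<lambda>i j. unit_mat i j 1 :: complex^('n::finite + 'n)^('n + 'n)"
  have 1: "(\<Sum>i\<in>UNIV. \<Sum>j\<in>UNIV. ad_ad X Y (?u i j) $ i $ j) = 4 * of_nat CARD('n) * trace (X ** Y)"
  proof -
    \<comment> \<open>Padding with \<open>mat 1\<close> brings all four terms into the shape M Z N.
      The mixed ones vanish because X and Y have trace 0; each outer one carries the trace 2n of the
      identity.\<close>
    have "ad_ad X Y Z = (X ** Y) ** Z ** mat 1 - X ** Z ** Y - Y ** Z ** X + mat 1 ** Z ** (Y ** X)" for Z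
      by (simp add: ad_ad_expand)
    then have "(\<Sum>i\<in>UNIV. \<Sum>j\<in>UNIV. ad_ad X Y (?u i j) $ i $ j)
      = trace (X ** Y) * trace (mat 1 :: complex^('n::finite + 'n)^('n + 'n)) - trace X * trace Y - trace Y * trace X
        + trace (mat 1 :: complex^('n::finite + 'n)^('n + 'n)) * trace (Y ** X)"
      by (simp only: vector_add_component vector_minus_component sum.distrib sum_subtractf trace_mult_both)
    then show ?thesis
      using assms by (simp add: trace_sp_complex trace_mul_sym[of Y X] trace_I)
  qed
  have 2: "(\<Sum>i\<in>UNIV. \<Sum>j\<in>UNIV. ad_ad X Y (theta ** transpose (?u i j) ** theta) $ i $ j) = 4 * trace (X ** Y)"
  proof -
    \<comment> \<open>Now every term contributes tr (X Y): the outer ones because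
      \<open>theta\<close> is orthogonal, the mixed ones because theta A^t theta = A on
      \<open>sp_complex\<close>.\<close>
    have "ad_ad X Y (theta ** Z ** theta) = (X ** Y ** theta) ** Z ** theta - (X ** theta) ** Z ** (theta ** Y)
        - (Y ** theta) ** Z ** (theta ** X) + theta ** Z ** (theta ** (Y ** X))" for Z
      by (simp add: ad_ad_expand matrix_mul_assoc)
    then have "(\<Sum>i\<in>UNIV. \<Sum>j\<in>UNIV. ad_ad X Y (theta ** transpose (?u i j) ** theta) $ i $ j)
      = trace (transpose (X ** Y ** theta) ** theta) - trace (transpose (X ** theta) ** (theta ** Y))
        - trace (transpose (Y ** theta) ** (theta ** X)) + trace (transpose theta ** (theta ** (Y ** X)))"
      by (simp only: vector_add_component vector_minus_component sum.distrib sum_subtractf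
          trace_mult_both_transpose)
    moreover have "trace (transpose (X ** Y ** theta) ** theta) = trace (X ** Y)"
    proof -
      have "trace (transpose (X ** Y ** theta) ** theta) = - trace (theta ** (transpose (X ** Y) ** theta))"
        by (simp add: matrix_transpose_mul transpose_theta matrix_distribs matrix_mul_assoc trace_minus)
      also have "\<dots> = - trace (transpose (X ** Y) ** theta ** theta)"
        by (subst trace_mul_sym) simp
      also have "\<dots> = trace (transpose (X ** Y))"
        by (simp add: matrix_mul_assoc[symmetric] theta_theta matrix_distribs trace_minus)
      finally show ?thesis
        by (simp add: trace_component transpose_component)
    qed
    moreover have "trace (transpose (A ** theta) ** (theta ** B)) = - trace (A ** B)"
      if "A \<in> sp_complex" for A B :: "complex^('n::finite + 'n)^('n + 'n)"
    proof -
      have "transpose (A ** theta) ** (theta ** B) = - ((theta ** transpose A ** theta) ** B)"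
        by (simp add: matrix_transpose_mul transpose_theta matrix_distribs matrix_mul_assoc)
      also have "\<dots> = - (A ** B)"
        using that by (simp add: sp_complex_iff)
      finally show ?thesis
        by (simp add: trace_minus)
    qed
    moreover have "transpose theta ** (theta ** (Y ** X)) = Y ** X"
      by (simp add: transpose_theta matrix_distribs matrix_mul_assoc)
        (simp add: theta_theta matrix_distribs)
    ultimately show ?thesis
      using assms by (simp add: trace_mul_sym[of Y X])
  qed
  have "(\<Sum>i\<in>UNIV. \<Sum>j\<in>UNIV. ad_ad X Y (proj_sp_complex (?u i j)) $ i $ j)
    = (1/2) *\<^sub>R ((\<Sum>i\<in>UNIV. \<Sum>j\<in>UNIV. ad_ad X Y (?u i j) $ i $ j)
      + (\<Sum>i\<in>UNIV. \<Sum>j\<in>UNIV. ad_ad X Y (theta ** transpose (?u i j) ** theta) $ i $ j))"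
    by (simp add: proj_sp_complex_def linear_add[OF linear_ad_ad] linear_scale[OF linear_ad_ad]
        sum.distrib scaleR_sum_right scaleR_right_distrib)
  then show ?thesis
    unfolding 1 2 by (simp add: scaleR_conv_of_real algebra_simps)
qed

lemma killing_form_sp_complex:
  fixes X Y :: "complex^('n::finite + 'n)^('n + 'n)"
  assumes "X \<in> sp_complex" "Y \<in> sp_complex"
  shows "killing_form sp_complex X Y = 4 * (real CARD('n) + 1) * Re (trace (X ** Y))"
proof -
  have "killing_form sp_complex X Y = (\<Sum>b\<in>Basis. ad_ad X Y (proj_sp_complex b) \<bullet> b)"
    unfolding killing_form_def ad_ad_def[symmetric]
    using assms by (intro trace_on_eq_sum_Basis subspace_sp_complex linear_ad_ad linear_proj_sp_complex
        proj_sp_complex_in proj_sp_complex_id) (simp_all add: ad_ad_def bracket_sp_complex)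
  also have "\<dots> = 2 * Re (2 * (of_nat CARD('n) + 1) * trace (X ** Y))"
    by (subst sum_Basis_complex_linear)
      (simp_all only: smult_ad_ad smult_proj_sp_complex trace_ad_ad_proj[OF assms])
  finally show ?thesis
    by simp
qed

text \<open>
  The projection onto \<open>sp\<close> is half the projection onto \<open>sp_complex\<close> plus an antilinear map,
  and the latter contributes nothing to the trace.
\<close>
lemma killing_form_sp:
  fixes X Y :: "complex^('n::finite + 'n)^('n + 'n)"
  assumes "X \<in> sp" "Y \<in> sp"
  shows "killing_form sp X Y = 2 * (real CARD('n) + 1) * Re (trace (X ** Y))"
proof -
  let ?P = proj_sp_complex
  have c: "X \<in> sp_complex" "Y \<in> sp_complex"
    using assms by (auto simp: sp_iff)
  have "killing_form sp X Y = (\<Sum>b\<in>Basis. ad_ad X Y (proj_sp b) \<bullet> b)"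
    unfolding killing_form_def ad_ad_def[symmetric]
    using assms by (intro trace_on_eq_sum_Basis subspace_sp linear_ad_ad linear_proj_sp
        proj_sp_in proj_sp_id) (simp_all add: ad_ad_def bracket_sp)
  also have "\<dots> = (1/2) * ((\<Sum>b\<in>Basis. ad_ad X Y (?P b) \<bullet> b)
      - (\<Sum>b\<in>Basis. ad_ad X Y (transpose (cnj_mat (?P b))) \<bullet> b))"
    by (simp add: proj_sp_def linear_diff[OF linear_ad_ad] linear_scale[OF linear_ad_ad]
        sum_subtractf sum_distrib_left inner_diff_left algebra_simps)
  also have "(\<Sum>b\<in>Basis. ad_ad X Y (transpose (cnj_mat (?P b))) \<bullet> b) = 0"
  proof (rule sum_Basis_complex_antilinear)
    have "smult_mat (cnj \<i>) M = - smult_mat \<i> M" for M :: "complex^('n::finite + 'n)^('n + 'n)"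
      by (simp add: vec_eq_iff)
    then show "ad_ad X Y (transpose (cnj_mat (?P (smult_mat \<i> M))))
        = - smult_mat \<i> (ad_ad X Y (transpose (cnj_mat (?P M))))" for M
      by (simp only: smult_proj_sp_complex smult_mat_add transpose_minus smult_ad_ad
          linear_neg[OF linear_ad_ad])
  qed
  also have "(\<Sum>b\<in>Basis. ad_ad X Y (?P b) \<bullet> b) = 2 * Re (2 * (of_nat CARD('n) + 1) * trace (X ** Y))"
    by (subst sum_Basis_complex_linear)
      (simp_all only: smult_ad_ad smult_proj_sp_complex trace_ad_ad_proj[OF c])
  finally show ?thesis
    by simp
qed

text \<open>Makes the trace form the Euclidean inner product on symmetric matrices, from which
  definiteness is read off.\<close>

lemma Re_trace_sym_mult_cnj:
  fixes M N :: "complex^'n^'n"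
  assumes "transpose N = N"
  shows "Re (trace (M ** cnj_mat N)) = M \<bullet> N"
proof -
  have "N $ j $ i = N $ i $ j" for i j
    using assms by (metis transpose_component)
  then show ?thesis
    by (simp add: trace_component matrix_mult_component inner_vec_def inner_complex_def)
qed

text \<open>The factor -2 of \<open>trace_mult_sp_m\<close> turns 2 (n + 1) into -4 (n + 1) for
  \<open>sp\<close>. The constant -8 (n + 1) belongs to \<open>sp_complex\<close>, whose real
  Killing form is twice as large on \<open>sp\<close>.\<close>

lemma killing_form_sp_m:
  fixes X Y :: "complex^('n::finite + 'n)^('n + 'n)"
  assumes "X \<in> sp_m" "Y \<in> sp_m"
  shows "killing_form sp X Y = - 4 * (real CARD('n) + 1) * Re (trace (m_id X ** cnj_mat (m_id Y)))"
    and "killing_form sp_complex X Y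
      = - 8 * (real CARD('n) + 1) * Re (trace (m_id X ** cnj_mat (m_id Y)))"
proof -
  have "X \<in> sp" "Y \<in> sp" "X \<in> sp_complex" "Y \<in> sp_complex"
    using assms by (auto simp: sp_m_def sp_iff)
  then show "killing_form sp X Y = - 4 * (real CARD('n) + 1) * Re (trace (m_id X ** cnj_mat (m_id Y)))"
    and "killing_form sp_complex X Y
      = - 8 * (real CARD('n) + 1) * Re (trace (m_id X ** cnj_mat (m_id Y)))"
    by (simp_all add: killing_form_sp killing_form_sp_complex trace_mult_sp_m[OF assms]
        algebra_simps)
qed

lemma neg_def_killing_form:
  "neg_def_inner_product_on (sp_m :: (complex^('n::finite + 'n)^('n + 'n)) set) (killing_form sp)"
proof -
  have k: "killing_form sp X Y = - 4 * (real CARD('n) + 1) * (m_id X \<bullet> m_id Y)"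
    if "X \<in> sp_m" "Y \<in> sp_m" for X Y :: "complex^('n::finite + 'n)^('n + 'n)"
    using killing_form_sp_m(1)[OF that] Re_trace_sym_mult_cnj[OF m_id_sym[OF that(2)]] by simp
  have 0: "m_id X \<noteq> 0" if "X \<in> sp_m" "X \<noteq> 0" for X :: "complex^('n::finite + 'n)^('n + 'n)"
    using inj_onD[OF bij_betw_imp_inj_on[OF bij_betw_m_id], of X 0] that
    by (auto simp: linear_0[OF linear_m_id] subspace_0[OF subspace_sp_m])
  show ?thesis
    unfolding neg_def_inner_product_on_def
  proof (intro conjI ballI allI impI)
    fix X Y Z :: "complex^('n::finite + 'n)^('n + 'n)" and r s :: real
    assume "X \<in> sp_m" "Y \<in> sp_m" "Z \<in> sp_m"
    moreover from this have "r *\<^sub>R X + s *\<^sub>R Y \<in> sp_m"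
      by (intro subspace_add subspace_scale subspace_sp_m)
    ultimately show "killing_form sp (r *\<^sub>R X + s *\<^sub>R Y) Z
        = r * killing_form sp X Z + s * killing_form sp Y Z"
      by (simp add: k linear_add[OF linear_m_id] linear_scale[OF linear_m_id] inner_add_left algebra_simps)
  next
    fix X Y :: "complex^('n::finite + 'n)^('n + 'n)"
    assume "X \<in> sp_m" "Y \<in> sp_m"
    then show "killing_form sp X Y = killing_form sp Y X"
      by (simp add: k inner_commute)
  next
    fix X :: "complex^('n::finite + 'n)^('n + 'n)"
    assume "X \<in> sp_m" "X \<noteq> 0"
    then have "0 < 4 * (real CARD('n) + 1) * (m_id X \<bullet> m_id X)"
      using 0[of X] by (intro mult_pos_pos) auto
    then show "killing_form sp X X < 0"
      unfolding k[OF \<open>X \<in> sp_m\<close> \<open>X \<in> sp_m\<close>] by linarith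
  qed
qed

section \<open>Dimensions\<close>

lemma dim_m_id_image:
  assumes "subspace V" "V \<subseteq> sp_m"
  shows "dim (m_id ` V) = dim V"
proof (rule dim_image_eq[OF linear_m_id])
  show "inj_on m_id (span V)"
    using assms bij_betw_imp_inj_on[OF bij_betw_m_id] by (metis inj_on_subset span_eq_iff)
qed

lemma subspace_sym: "subspace {M :: complex^'n^'n. transpose M = M}"
  by (rule subspaceI) (simp_all add: transpose_add transpose_scalar, simp add: vec_eq_iff transpose_component)

lemma dim_sym: "dim {M :: complex^'n^'n. transpose M = M} = CARD('n)\<^sup>2 + CARD('n)"
proof -
  let ?P = "\<lambda>M :: complex^'n^'n. (1/2) *\<^sub>R (M + transpose M)"
  have "linear ?P"
    by (rule linearI) (simp_all add: transpose_add transpose_scalar scaleR_right_distrib)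
  then have "real (dim {M :: complex^'n^'n. transpose M = M}) = (\<Sum>b\<in>Basis. ?P b \<bullet> b)"
    by (rule dim_eq_trace_of_projection[OF subspace_sym])
      (simp_all add: transpose_add transpose_scalar add.commute scaleR_2[symmetric])
  \<comment> \<open>Off the diagonal E_ij and i E_ij contribute 1/2 each, on the diagonal 1
    each.\<close>
  also have "\<dots> = (\<Sum>i\<in>(UNIV :: 'n set). \<Sum>j\<in>UNIV. 1 + (if i = j then 1 else 0))"
    unfolding sum_Basis_cmat transpose_unit_mat
    by (intro sum.cong refl) (auto simp: axis_def)
  also have "\<dots> = real (CARD('n)\<^sup>2 + CARD('n))"
    by (simp add: sum.distrib power2_eq_square algebra_simps)
  finally show ?thesis
    by linarith
qed

lemma dim_sp_m: "dim (sp_m :: (complex^('n::finite + 'n)^('n + 'n)) set) = CARD('n)\<^sup>2 + CARD('n)"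
  using dim_m_id_image[of "sp_m :: (complex^('n::finite + 'n)^('n + 'n)) set", OF subspace_sp_m order_refl]
  unfolding bij_betw_imp_surj_on[OF bij_betw_m_id] dim_sym by simp

section \<open>Commuting self-adjoint maps\<close>

text \<open>The maximum of the Rayleigh quotient on the unit sphere of \<open>W\<close> is attained at an eigenvector.\<close>
lemma self_adjoint_eigenvector:
  fixes T :: "'v::euclidean_space \<Rightarrow> 'v"
  assumes W: "subspace W" "W \<noteq> {0}" and T: "linear T" "\<And>x. x \<in> W \<Longrightarrow> T x \<in> W"
    and sa: "\<And>x y. T x \<bullet> y = x \<bullet> T y"
  obtains u l where "u \<in> W" "u \<noteq> 0" "T u = l *\<^sub>R u"
proof -
  define S where "S = W \<inter> sphere 0 1"
  obtain w where w: "w \<in> W" "w \<noteq> 0"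
    using W subspace_0 by blast
  then have "w /\<^sub>R norm w \<in> S"
    by (simp add: S_def subspace_scale[OF W(1)])
  then have "S \<noteq> {}"
    by blast
  moreover have "compact S"
    unfolding S_def by (intro closed_Int_compact closed_subspace W(1)) simp
  moreover have "continuous_on S (\<lambda>x. x \<bullet> T x)"
    by (intro continuous_intros linear_continuous_on linear_conv_bounded_linear[THEN iffD1] T(1))
  ultimately obtain u where u: "u \<in> S" and max: "\<And>x. x \<in> S \<Longrightarrow> x \<bullet> T x \<le> u \<bullet> T u"
    using continuous_attains_sup[of S "\<lambda>x. x \<bullet> T x"] by blast
  define l where "l = u \<bullet> T u"
  have uW: "u \<in> W" and uu: "u \<bullet> u = 1"
    using u by (simp_all add: S_def dot_square_norm)
  have le: "x \<bullet> T x \<le> l * (x \<bullet> x)" if "x \<in> W" for x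
  proof (cases "x = 0")
    case False
    then have "(x /\<^sub>R norm x) \<bullet> T (x /\<^sub>R norm x) \<le> l"
      unfolding l_def by (intro max) (simp add: S_def subspace_scale[OF W(1)] that)
    then have "(x \<bullet> T x) / (norm x)\<^sup>2 \<le> l"
      by (simp add: linear_scale[OF T(1)] power2_eq_square divide_inverse mult.commute mult.left_commute)
    then show ?thesis
      using False by (simp add: divide_le_eq dot_square_norm)
  qed simp
  \<comment> \<open>The residual of the eigenvector equation. It is orthogonal to u, and the rest of
    the proof shows that it vanishes.\<close>
  define y where "y = T u - l *\<^sub>R u"
  have yW: "y \<in> W"
    unfolding y_def by (intro subspace_diff subspace_scale W(1) T(2) uW)
  have yu: "y \<bullet> u = 0"
    by (simp add: y_def inner_diff_left uu l_def inner_commute[of "T u" u])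
  have yTu: "y \<bullet> T u = y \<bullet> y"
  proof -
    have "y \<bullet> y = y \<bullet> T u - l * (y \<bullet> u)"
      by (subst (2) y_def) (simp add: inner_diff_right)
    then show ?thesis
      by (simp add: yu)
  qed
  \<comment> \<open>Variation of the maximizer: \<open>le\<close> at u + t y, where the terms free
    of t cancel. The left side is linear in t and the right side quadratic, so small t gives a
    contradiction unless y = 0.\<close>
  have quad: "2 * t * (y \<bullet> y) \<le> t\<^sup>2 * (l * (y \<bullet> y) - y \<bullet> T y)" for t
  proof -
    have "(u + t *\<^sub>R y) \<bullet> T (u + t *\<^sub>R y) \<le> l * ((u + t *\<^sub>R y) \<bullet> (u + t *\<^sub>R y))"
      by (intro le subspace_add subspace_scale W(1) uW yW)
    moreover have "u \<bullet> T y = y \<bullet> y"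
      using sa[of u y] yTu by (simp add: inner_commute)
    ultimately show ?thesis
      using yTu yu uu
      by (simp add: linear_add[OF T(1)] linear_scale[OF T(1)] inner_add_left inner_add_right
          l_def[symmetric] inner_commute[of u y] algebra_simps power2_eq_square)
  qed
  have "y \<bullet> y \<le> 0"
  proof (rule ccontr)
    assume "\<not> y \<bullet> y \<le> 0"
    then have pos: "0 < y \<bullet> y"
      by (rule not_le_imp_less)
    \<comment> \<open>A bound for the coefficient of t^2, made positive by the 1. The choice of t
      then reduces \<open>quad\<close> to 2 t (y \<bullet> y) \<le> t (y \<bullet> y).\<close>
    define c where "c = \<bar>l * (y \<bullet> y) - y \<bullet> T y\<bar> + 1"
    define t where "t = (y \<bullet> y) / c"
    have c: "0 < c" "l * (y \<bullet> y) - y \<bullet> T y \<le> c"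
      by (auto simp: c_def)
    then have t: "0 < t"
      using pos by (simp add: t_def)
    have "2 * t * (y \<bullet> y) \<le> t\<^sup>2 * c"
      using quad[of t] mult_left_mono[OF c(2), of "t\<^sup>2"] by simp
    also have "\<dots> = t * (y \<bullet> y)"
      using c by (simp add: t_def power2_eq_square)
    finally show False
      using t pos by (simp add: mult_pos_pos not_le)
  qed
  then have "y = 0"
    by (metis inner_eq_zero_iff inner_ge_zero order_antisym)
  then have "T u = l *\<^sub>R u"
    by (simp add: y_def)
  moreover have "u \<noteq> 0"
    using uu by auto
  ultimately show ?thesis
    using that uW by blast
qed

text \<open>On an invariant subspace of minimal dimension every map of the family is a scalar.\<close>
lemma common_eigenvector:
  fixes F :: "('v::euclidean_space \<Rightarrow> 'v) set"
  assumes W: "subspace W" "W \<noteq> {0}"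
    and lin: "\<And>T. T \<in> F \<Longrightarrow> linear T"
    and inv: "\<And>T x. T \<in> F \<Longrightarrow> x \<in> W \<Longrightarrow> T x \<in> W"
    and sa: "\<And>T x y. T \<in> F \<Longrightarrow> T x \<bullet> y = x \<bullet> T y"
    and comm: "\<And>S T x. S \<in> F \<Longrightarrow> T \<in> F \<Longrightarrow> S (T x) = T (S x)"
  obtains u where "u \<in> W" "u \<noteq> 0" "\<And>T. T \<in> F \<Longrightarrow> \<exists>l. T u = l *\<^sub>R u"
proof -
  define good where "good U \<longleftrightarrow> subspace U \<and> U \<subseteq> W \<and> U \<noteq> {0} \<and> (\<forall>T\<in>F. \<forall>x\<in>U. T x \<in> U)" for U
  have "good W"
    using assms by (auto simp: good_def)
  then obtain U where U: "good U" and min: "\<And>U'. good U' \<Longrightarrow> dim U \<le> dim U'"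
    using ex_has_least_nat[of good W dim] by blast
  have sub: "subspace U" "U \<subseteq> W" "U \<noteq> {0}" and invU: "\<And>T x. T \<in> F \<Longrightarrow> x \<in> U \<Longrightarrow> T x \<in> U"
    using U by (auto simp: good_def)
  have scalar: "\<exists>l. \<forall>x\<in>U. T x = l *\<^sub>R x" if T: "T \<in> F" for T
  proof -
    obtain u l where u: "u \<in> U" "u \<noteq> 0" "T u = l *\<^sub>R u"
      using self_adjoint_eigenvector[OF sub(1,3) lin[OF T] invU[OF T] sa[OF T]] by blast
    \<comment> \<open>The eigenspace of T inside U. Commutation makes it invariant under the whole
      family, so minimality of U forces it to be U.\<close>
    define U' where "U' = {x \<in> U. T x = l *\<^sub>R x}"
    have "subspace U'"
      unfolding U'_def using sub(1) lin[OF T]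
      by (intro subspaceI)
        (auto simp: subspace_0 subspace_add subspace_scale linear_0 linear_add linear_scale
          scaleR_right_distrib)
    moreover have "S x \<in> U'" if "S \<in> F" "x \<in> U'" for S x
      using that invU comm[OF T \<open>S \<in> F\<close>, of x] linear_scale[OF lin[OF \<open>S \<in> F\<close>]]
      by (auto simp: U'_def)
    ultimately have "good U'"
      using sub(2) u by (auto simp: good_def U'_def)
    then have "U' = U"
      using min[of U'] \<open>subspace U'\<close> sub(1)
      by (intro subspace_dim_equal) (auto simp: U'_def)
    then show ?thesis
      by (auto simp: U'_def)
  qed
  obtain u where "u \<in> U" "u \<noteq> 0"
    using sub(1,3) subspace_0 by blast
  then show ?thesis
    using that scalar sub(2) by (metis subsetD)
qed

section \<open>Commuting complex symmetric matrices\<close>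

definition herm :: "complex^'n \<Rightarrow> complex^'n \<Rightarrow> complex" where
  "herm x y = (\<Sum>i\<in>UNIV. x $ i * cnj (y $ i))"

definition vcnj :: "complex^'n \<Rightarrow> complex^'n" where
  "vcnj x = (\<chi> i. cnj (x $ i))"

text \<open>No conjugation occurs: this is the symmetric x x^t, not the hermitian x (cnj
  x)^t.\<close>

definition outer :: "complex^'n \<Rightarrow> complex^'n^'n" where
  "outer x = (\<chi> i j. x $ i * x $ j)"

definition antilin :: "complex^'n^'n \<Rightarrow> complex^'n \<Rightarrow> complex^'n" where
  "antilin M x = M *v vcnj x"

lemma herm_add_left: "herm (x + y) z = herm x z + herm y z"
  by (simp add: herm_def algebra_simps sum.distrib)

lemma herm_diff_left: "herm (x - y) z = herm x z - herm y z"
  by (simp add: herm_def algebra_simps sum_subtractf)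

lemma herm_smult_left: "herm (c *s x) z = c * herm x z"
  by (simp add: herm_def sum_distrib_left algebra_simps)

lemma scaleR_eq_smult: "r *\<^sub>R x = complex_of_real r *s x" for x :: "complex^'n"
  by (simp add: vec_eq_iff) (simp add: scaleR_conv_of_real)

lemma herm_scaleR_left: "herm (r *\<^sub>R x) z = r * herm x z"
  by (simp add: scaleR_eq_smult herm_smult_left)

lemma herm_sum_left: "herm (\<Sum>e\<in>E. f e) z = (\<Sum>e\<in>E. herm (f e) z)"
  by (simp add: herm_def sum_distrib_right) (rule sum.swap)

lemma herm_zero_left: "herm 0 z = 0"
  by (simp add: herm_def)

lemma cnj_herm: "cnj (herm x y) = herm y x"
  by (simp add: herm_def mult.commute)

lemma Re_herm: "Re (herm x y) = x \<bullet> y"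
  by (simp add: herm_def inner_vec_def inner_complex_def)

lemma herm_self: "herm x x = complex_of_real (x \<bullet> x)"
  using Re_herm[of x x] cnj_herm[of x x] by (simp add: complex_eq_iff)

lemma linear_antilin: "linear (antilin M)"
  by (rule linearI)
    (simp_all add: antilin_def vcnj_def vec_eq_iff matrix_vector_mult_def algebra_simps
      sum.distrib scaleR_sum_right)

lemma antilin_smult: "antilin M (c *s x) = cnj c *s antilin M x"
  by (simp add: antilin_def vcnj_def vec_eq_iff matrix_vector_mult_def sum_distrib_left
      mult.left_commute)

lemma antilin_sum: "antilin M (\<Sum>e\<in>E. f e) = (\<Sum>e\<in>E. antilin M (f e))"
  by (rule linear_sum[OF linear_antilin])

text \<open>Turns the relation of \<open>bracket_m_m_eq_0_iff\<close> into commutation of the two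
  antilinear maps.\<close>

lemma antilin_antilin: "antilin M (antilin N x) = (M ** cnj_mat N) *v x"
proof -
  have "vcnj (N *v vcnj x) = cnj_mat N *v x"
    by (simp add: vcnj_def vec_eq_iff matrix_vector_mult_def)
  then show ?thesis
    by (simp add: antilin_def matrix_vector_mul_assoc)
qed

lemma antilin_inject: "antilin M = antilin N \<Longrightarrow> M = N"
proof -
  assume "antilin M = antilin N"
  then have "M *v vcnj (vcnj x) = N *v vcnj (vcnj x)" for x
    by (metis antilin_def)
  then show "M = N"
    by (simp add: matrix_eq vcnj_def)
qed

text \<open>Both sides are the symmetric bilinear form of M at the conjugates of x and y. The real
  part is self-adjointness; the complex identity serves for the invariance of a hermitian
  complement.\<close>

lemma herm_antilin:
  assumes "transpose M = M"
  shows "herm (antilin M x) y = herm (antilin M y) x"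
proof -
  have "M $ j $ i = M $ i $ j" for i j
    using assms by (metis transpose_component)
  then have "herm (antilin M x) y = (\<Sum>i\<in>UNIV. \<Sum>j\<in>UNIV. M $ j $ i * cnj (x $ j) * cnj (y $ i))"
    by (simp add: herm_def antilin_def vcnj_def matrix_vector_mult_def sum_distrib_right)
  also have "\<dots> = (\<Sum>j\<in>UNIV. \<Sum>i\<in>UNIV. M $ j $ i * cnj (x $ j) * cnj (y $ i))"
    by (rule sum.swap)
  also have "\<dots> = herm (antilin M y) x"
    by (simp add: herm_def antilin_def vcnj_def matrix_vector_mult_def sum_distrib_right
        sum_distrib_left mult.commute mult.left_commute)
  finally show ?thesis .
qed

lemma antilin_self_adjoint:
  assumes "transpose M = M"
  shows "antilin M x \<bullet> y = x \<bullet> antilin M y"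
  using herm_antilin[OF assms, of x y] by (metis Re_herm inner_commute)

lemma antilin_outer: "antilin (outer e) x = herm e x *s e"
  by (simp add: antilin_def outer_def vcnj_def vec_eq_iff matrix_vector_mult_def herm_def
      sum_distrib_left sum_distrib_right algebra_simps)

text \<open>The right side is the real part of the square of \<open>herm e f\<close>, so a unitary
  family has orthonormal outer products.\<close>

lemma inner_outer: "outer e \<bullet> outer f = (cmod (herm e f))\<^sup>2 - 2 * (Im (herm e f))\<^sup>2"
proof -
  have "complex_of_real (outer e \<bullet> outer f) = complex_of_real (Re ((herm e f)\<^sup>2))"
    by (simp add: herm_def power2_eq_square sum_product inner_vec_def outer_def inner_complex_def
        algebra_simps)
  then show ?thesis
    by (simp add: cmod_power2) (simp add: power2_eq_square)
qed

text \<open>Take a largest unitary family of common eigenvectors with real eigenvalues. Its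
  hermitian complement is invariant, so if nonzero it would contain one more common
  eigenvector.\<close>

lemma simultaneous_takagi:
  fixes Z :: "(complex^'n^'n) set"
  assumes sym: "\<And>M. M \<in> Z \<Longrightarrow> transpose M = M"
    and comm: "\<And>M N. M \<in> Z \<Longrightarrow> N \<in> Z \<Longrightarrow> M ** cnj_mat N = N ** cnj_mat M"
  obtains E where "finite E" "card E = CARD('n)"
    "\<And>e f. e \<in> E \<Longrightarrow> f \<in> E \<Longrightarrow> herm e f = (if e = f then 1 else 0)"
    "Z \<subseteq> span (outer ` E)"
proof -
  \<comment> \<open>Real eigenvalues are what puts Z into the real span of the outer
    products.\<close>
  define good where "good E \<longleftrightarrow>
    (\<forall>e\<in>E. \<forall>f\<in>E. herm e f = (if e = f then 1 else 0)) \<and>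
    (\<forall>e\<in>E. \<forall>M\<in>Z. \<exists>l::real. antilin M e = l *\<^sub>R e)" for E :: "(complex^'n) set"
  have ind: "independent E" if "good E" for E
  proof (rule pairwise_orthogonal_independent)
    show "pairwise orthogonal E"
      using that by (auto simp: good_def pairwise_def orthogonal_def Re_herm[symmetric])
    show "0 \<notin> E"
      using that unfolding good_def by (metis herm_zero_left zero_neq_one)
  qed
  have "good {}"
    by (simp add: good_def)
  \<comment> \<open>Unitary families are independent over the reals, so the real dimension bounds
    their size and a largest one exists.\<close>
  moreover have "\<forall>E. good E \<longrightarrow> card E < Suc (DIM(complex^'n))"
    using ind independent_bound le_imp_less_Suc by blast
  ultimately obtain E where E: "good E" and max: "\<And>E'. good E' \<Longrightarrow> card E' \<le> card E"
    using ex_has_greatest_nat[of good "{}" card "Suc (DIM(complex^'n))"] by blast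
  have fin: "finite E"
    using ind[OF E] by (rule finiteI_independent)
  have on: "herm e f = (if e = f then 1 else 0)" if "e \<in> E" "f \<in> E" for e f
    using E that by (simp add: good_def)
  have "\<exists>l::real. antilin M e = l *\<^sub>R e" if "e \<in> E" "M \<in> Z" for e M
    using E that by (simp add: good_def)
  then obtain l :: "complex^'n \<Rightarrow> complex^'n^'n \<Rightarrow> real"
    where l: "\<And>e M. e \<in> E \<Longrightarrow> M \<in> Z \<Longrightarrow> antilin M e = l e M *\<^sub>R e"
    by metis
  \<comment> \<open>The complement for \<open>herm\<close>, not just for the real inner product, so
    that a unit vector of W extends the family unitarily.\<close>
  define W where "W = {x. \<forall>e\<in>E. herm x e = 0}"
  have W: "subspace W"
    by (rule subspaceI) (auto simp: W_def herm_zero_left herm_add_left herm_scaleR_left)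
  have "W = {0}"
  proof (rule ccontr)
    assume W0: "W \<noteq> {0}"
    have inv: "T x \<in> W" if "T \<in> antilin ` Z" "x \<in> W" for T x
    proof -
      obtain M where M: "M \<in> Z" "T = antilin M"
        using \<open>T \<in> antilin ` Z\<close> by blast
      have "herm (antilin M x) e = 0" if "e \<in> E" for e
      proof -
        have "herm (antilin M x) e = l e M * cnj (herm x e)"
          using that M by (simp add: herm_antilin[OF sym[OF M(1)], of x] l herm_scaleR_left cnj_herm)
        then show ?thesis
          using \<open>x \<in> W\<close> that by (simp add: W_def)
      qed
      then show ?thesis
        by (simp add: W_def M)
    qed
    obtain u where u: "u \<in> W" "u \<noteq> 0" "\<And>T. T \<in> antilin ` Z \<Longrightarrow> \<exists>l. T u = l *\<^sub>R u"
    proof (rule common_eigenvector[OF W W0, of "antilin ` Z"])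
      show "S (T x) = T (S x)" if "S \<in> antilin ` Z" "T \<in> antilin ` Z" for S T x
        using that comm by (auto simp: antilin_antilin)
    qed (auto simp: linear_antilin inv antilin_self_adjoint sym)
    define v where "v = u /\<^sub>R norm u"
    have vW: "herm v e = 0" "herm e v = 0" if "e \<in> E" for e
    proof -
      show "herm v e = 0"
        using u(1) that by (simp add: v_def W_def herm_scaleR_left)
      then show "herm e v = 0"
        by (metis cnj_herm complex_cnj_zero)
    qed
    have vv: "herm v v = 1"
      using u(2) by (simp add: herm_self v_def dot_square_norm)
    have "\<exists>l::real. antilin M v = l *\<^sub>R v" if "M \<in> Z" for M
      using u(3)[of "antilin M"] that
      by (auto simp: v_def linear_scale[OF linear_antilin] intro: exI mult.commute)
    then have "good (insert v E)"
      using E vW vv by (auto simp: good_def)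
    then have "card (insert v E) \<le> card E"
      by (rule max)
    moreover have "v \<notin> E"
      using vW(1)[of v] vv by auto
    ultimately show False
      using fin by simp
  qed
  have expand: "x = (\<Sum>e\<in>E. herm x e *s e)" for x
  proof -
    have "herm (x - (\<Sum>e\<in>E. herm x e *s e)) f = 0" if "f \<in> E" for f
    proof -
      have "herm (\<Sum>e\<in>E. herm x e *s e) f = (\<Sum>e\<in>E. herm x e * (if e = f then 1 else 0))"
        unfolding herm_sum_left herm_smult_left by (intro sum.cong refl) (simp add: on that)
      also have "\<dots> = herm x f"
        using fin that by (simp add: mult_delta_right)
      finally show ?thesis
        by (simp add: herm_diff_left)
    qed
    then have "x - (\<Sum>e\<in>E. herm x e *s e) \<in> W"
      by (simp add: W_def)
    then show ?thesis
      using \<open>W = {0}\<close> by simp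
  qed
  have card: "card E = CARD('n)"
  proof -
    \<comment> \<open>Double counting: each e has norm 1, and expanding the i-th axis vector in E
      shows that the squared moduli of the i-th coordinates over E sum to 1.\<close>
    have "of_nat (card E) = (\<Sum>e\<in>E. herm e e)"
      by (simp add: on)
    also have "\<dots> = (\<Sum>i\<in>UNIV. \<Sum>e\<in>E. cnj (e $ i) * e $ i)"
      unfolding herm_def by (subst sum.swap) (simp add: mult.commute)
    also have "\<dots> = (\<Sum>i\<in>(UNIV :: 'n set). (axis i 1 :: complex^'n) $ i)"
    proof (intro sum.cong refl)
      fix i :: 'n
      have "herm (axis i 1) e = cnj (e $ i)" for e :: "complex^'n"
        by (simp add: herm_def axis_def mult_delta_left)
      then show "(\<Sum>e\<in>E. cnj (e $ i) * e $ i) = (axis i 1 :: complex^'n) $ i"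
        by (subst expand[of "axis i 1"]) (simp add: sum_component)
    qed
    also have "\<dots> = of_nat CARD('n)"
      by (simp add: axis_def)
    finally show ?thesis
      using of_nat_eq_iff by blast
  qed
  have "M \<in> span (outer ` E)" if M: "M \<in> Z" for M
  proof -
    \<comment> \<open>Compare both maps on the expansion of x: antilinearity of M turns the
      coefficient \<open>herm x e\<close> into \<open>herm e x\<close>, which is the coefficient
      produced by \<open>outer e\<close>.\<close>
    have "antilin M x = antilin (\<Sum>e\<in>E. l e M *\<^sub>R outer e) x" for x
    proof -
      have "antilin (\<Sum>e\<in>E. l e M *\<^sub>R outer e) x = (\<Sum>e\<in>E. l e M *\<^sub>R antilin (outer e) x)"
        by (simp add: antilin_def vec_eq_iff matrix_vector_mult_def sum_component sum_distrib_right
            scaleR_sum_right) (intro allI sum.swap)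
      also have "\<dots> = (\<Sum>e\<in>E. antilin M (herm x e *s e))"
        using M by (intro sum.cong refl)
          (simp add: antilin_outer antilin_smult l cnj_herm vec_eq_iff)
      also have "\<dots> = antilin M x"
        by (simp add: antilin_sum[symmetric] expand[symmetric])
      finally show ?thesis
        by simp
    qed
    then have "M = (\<Sum>e\<in>E. l e M *\<^sub>R outer e)"
      by (intro antilin_inject ext)
    also have "\<dots> \<in> span (outer ` E)"
      by (intro span_sum span_scale span_base) simp
    finally show ?thesis .
  qed
  then show ?thesis
    using that fin card on by blast
qed

section \<open>Cartan subspaces\<close>

lemma real_diagonal_iff:
  "real_diagonal M \<longleftrightarrow> (\<forall>i j. Im (M $ i $ j) = 0 \<and> (i \<noteq> j \<longrightarrow> M $ i $ j = 0))"
proof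
  assume *: "\<forall>i j. Im (M $ i $ j) = 0 \<and> (i \<noteq> j \<longrightarrow> M $ i $ j = 0)"
  then have "M = (\<chi> i j. if i = j then complex_of_real (Re (M $ i $ i)) else 0)"
    by (simp add: vec_eq_iff complex_eq_iff)
  then show "real_diagonal M"
    unfolding real_diagonal_def by (intro exI[of _ "\<lambda>i. Re (M $ i $ i)"])
qed (auto simp: real_diagonal_def)

lemma real_diagonal_sym: "real_diagonal M \<Longrightarrow> transpose M = M"
  by (auto simp: real_diagonal_def vec_eq_iff transpose_component)

lemma subspace_real_diagonal: "subspace {M. real_diagonal M}"
  by (rule subspaceI) (auto simp: real_diagonal_iff)

lemma dim_real_diagonal: "dim {M :: complex^'n^'n. real_diagonal M} = CARD('n)"
proof -
  let ?P = "\<lambda>M :: complex^'n^'n. \<chi> i j. if i = j then complex_of_real (Re (M $ i $ i)) else 0"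
  have "linear ?P"
    by (rule linearI) (simp_all add: vec_eq_iff complex_eq_iff)
  then have "real (dim {M :: complex^'n^'n. real_diagonal M}) = (\<Sum>b\<in>Basis. ?P b \<bullet> b)"
    by (rule dim_eq_trace_of_projection[OF subspace_real_diagonal])
      (auto simp: real_diagonal_iff vec_eq_iff complex_eq_iff)
  also have "\<dots> = (\<Sum>i\<in>(UNIV :: 'n set). \<Sum>j\<in>UNIV. if i = j then 1 else 0)"
    unfolding sum_Basis_cmat by (intro sum.cong refl) (auto simp: unit_mat_nth)
  also have "\<dots> = real CARD('n)"
    by simp
  finally show ?thesis
    by linarith
qed

lemma m_id_surj:
  assumes "transpose M = M"
  obtains X where "X \<in> sp_m" "m_id X = M"
proof -
  have "M \<in> m_id ` sp_m"
    unfolding bij_betw_imp_surj_on[OF bij_betw_m_id] using assms by simp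
  then show ?thesis
    using that by auto
qed

lemma subspace_m_id_vimage:
  assumes "subspace V"
  shows "subspace {X \<in> sp_m. m_id X \<in> V}"
proof -
  have "{X \<in> sp_m. m_id X \<in> V} = sp_m \<inter> m_id -` V"
    by blast
  then show ?thesis
    by (simp only: subspace_inter[OF subspace_sp_m linear_subspace_vimage[OF linear_m_id assms]])
qed

lemma m_id_image_vimage:
  assumes "\<And>M. M \<in> V \<Longrightarrow> transpose M = M"
  shows "m_id ` {X \<in> sp_m. m_id X \<in> V} = V"
proof (intro equalityI subsetI)
  fix M
  assume "M \<in> V"
  then have "transpose M = M"
    by (rule assms)
  then obtain X where "X \<in> sp_m" "m_id X = M"
    by (rule m_id_surj)
  then show "M \<in> m_id ` {X \<in> sp_m. m_id X \<in> V}"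
    using \<open>M \<in> V\<close> by (intro image_eqI[of _ _ X]) simp_all
qed auto

lemma dim_m_id_vimage:
  assumes "subspace V" "\<And>M. M \<in> V \<Longrightarrow> transpose M = M"
  shows "dim {X \<in> sp_m. m_id X \<in> V} = dim V"
proof -
  have "dim (m_id ` {X \<in> sp_m. m_id X \<in> V}) = dim {X \<in> sp_m. m_id X \<in> V}"
    by (intro dim_m_id_image subspace_m_id_vimage assms(1)) blast
  then show ?thesis
    by (subst (asm) m_id_image_vimage) (rule assms(2), assumption, rule sym)
qed

lemma diag_subspace_eq: "diag_subspace = {X \<in> sp_m. real_diagonal (m_id X)}"
  using subspace_m_id_vimage[OF subspace_real_diagonal] by (simp add: diag_subspace_def)

lemma subspace_diag: "subspace diag_subspace"
  by (simp add: diag_subspace_def)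

lemma diag_subspace_subset: "diag_subspace \<subseteq> sp_m"
  by (auto simp: diag_subspace_eq)

lemma dim_diag_subspace:
  "dim (diag_subspace :: (complex^('n::finite + 'n)^('n + 'n)) set) = CARD('n)"
proof -
  have "dim {X \<in> sp_m. m_id X \<in> {M :: complex^'n^'n. real_diagonal M}}
      = dim {M :: complex^'n^'n. real_diagonal M}"
    by (intro dim_m_id_vimage subspace_real_diagonal) (simp add: real_diagonal_sym)
  then show ?thesis
    by (simp add: diag_subspace_eq dim_real_diagonal)
qed

lemma abelian_diag_subspace: "abelian_subspace diag_subspace"
  unfolding abelian_subspace_def
proof (intro conjI ballI subspace_diag)
  fix X Y :: "complex^('n::finite + 'n)^('n + 'n)"
  assume XY: "X \<in> diag_subspace" "Y \<in> diag_subspace"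
  have comm: "M ** cnj_mat N = (\<chi> i j. if i = j then M $ i $ i * N $ i $ i else 0)"
    if "real_diagonal M" "real_diagonal N" for M N :: "complex^'n^'n"
    using that by (auto simp: real_diagonal_def vec_eq_iff matrix_mult_component mult_delta_right
        if_distrib[of cnj] cong: if_cong)
  have "m_id Y ** cnj_mat (m_id X) = m_id X ** cnj_mat (m_id Y)"
    using XY by (simp add: diag_subspace_eq comm mult.commute cong: if_cong)
  then show "bracket X Y = 0"
    using XY by (subst bracket_m_m_eq_0_iff) (auto simp: diag_subspace_eq)
qed

lemma centralizer_diag_subspace: "centralizer_in sp_m diag_subspace = diag_subspace"
proof (intro equalityI subsetI)
  fix X :: "complex^('n::finite + 'n)^('n + 'n)"
  assume X: "X \<in> centralizer_in sp_m diag_subspace"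
  then have "X \<in> sp_m"
    by (simp add: centralizer_in_def)
  \<comment> \<open>Commuting with an element that corresponds to E_kk equates row k of E_kk (cnj M)
    with row k of M E_kk. Off-diagonal entries of M vanish and the diagonal ones equal their
    conjugates.\<close>
  have entry: "cnj (m_id X $ k $ l) = m_id X $ k $ k * (if k = l then 1 else 0)" for k l
  proof -
    let ?u = "unit_mat k k 1"
    have u: "real_diagonal ?u"
      by (auto simp: real_diagonal_iff unit_mat_nth)
    then obtain Y where Y: "Y \<in> sp_m" "m_id Y = ?u"
      using m_id_surj[OF real_diagonal_sym] by metis
    then have "bracket X Y = 0"
      using X u by (simp add: centralizer_in_def diag_subspace_eq)
    moreover have "cnj_mat ?u = ?u"
      by (simp add: vec_eq_iff unit_mat_nth)
    ultimately have "mat 1 ** ?u ** cnj_mat (m_id X) = m_id X ** ?u ** mat 1"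
      using bracket_m_m_eq_0_iff[OF \<open>X \<in> sp_m\<close> Y(1)] by (simp add: Y(2))
    then have "(mat 1 ** ?u ** cnj_mat (m_id X)) $ k $ l = (m_id X ** ?u ** mat 1) $ k $ l"
      by simp
    then show ?thesis
      unfolding unit_mat_mult_nth by (simp add: mat_def)
  qed
  have "real_diagonal (m_id X)"
    unfolding real_diagonal_iff
  proof (intro allI conjI impI)
    show "m_id X $ k $ l = 0" if "k \<noteq> l" for k l
      using entry[of k l] that by simp
    show "Im (m_id X $ k $ l) = 0" for k l
      using entry[of k l] by (cases "k = l") (simp_all add: complex_eq_iff)
  qed
  then show "X \<in> diag_subspace"
    by (simp add: diag_subspace_eq \<open>X \<in> sp_m\<close>)
next
  fix X :: "complex^('n::finite + 'n)^('n + 'n)"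
  assume "X \<in> diag_subspace"
  then show "X \<in> centralizer_in sp_m diag_subspace"
    using abelian_diag_subspace diag_subspace_subset
    by (auto simp: centralizer_in_def abelian_subspace_def)
qed

text \<open>An abelian subspace that contains the diagonal one centralizes it, so maximality follows
  from the computation of the centralizer.\<close>

lemma cartan_diag_subspace: "cartan_subspace sp_m diag_subspace"
proof -
  have "b = diag_subspace" if "b \<subseteq> sp_m" "abelian_subspace b" "diag_subspace \<subseteq> b"
    for b :: "(complex^('n::finite + 'n)^('n + 'n)) set"
  proof -
    have "b \<subseteq> centralizer_in sp_m diag_subspace"
      using that by (auto simp: centralizer_in_def abelian_subspace_def)
    then show ?thesis
      using that by (simp add: centralizer_diag_subspace)
  qed
  then show ?thesis
    unfolding cartan_subspace_def
    using diag_subspace_subset abelian_diag_subspace centralizer_diag_subspace by blast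
qed

section \<open>The dimension of an arbitrary Cartan subspace\<close>

lemma outer_mult_cnj_outer:
  "outer e ** cnj_mat (outer f) = (\<chi> i j. herm e f * (e $ i * cnj (f $ j)))"
  by (simp add: vec_eq_iff matrix_mult_component outer_def herm_def sum_distrib_left
      sum_distrib_right algebra_simps)

text \<open>The matrices e e^t are orthonormal, which gives the dimension. The product of e e^t with
  the conjugate of f f^t is a multiple of \<open>herm e f\<close> and vanishes for distinct e and f;
  real linearity in each argument extends the commutation to the span.\<close>

lemma span_outer:
  fixes E :: "(complex^'n) set"
  assumes on: "\<And>e f. e \<in> E \<Longrightarrow> f \<in> E \<Longrightarrow> herm e f = (if e = f then 1 else 0)"
  shows "dim (span (outer ` E)) = card E"
    and "M \<in> span (outer ` E) \<Longrightarrow> transpose M = M"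
    and "M \<in> span (outer ` E) \<Longrightarrow> N \<in> span (outer ` E) \<Longrightarrow> N ** cnj_mat M = M ** cnj_mat N"
proof -
  have io: "outer e \<bullet> outer f = (if e = f then 1 else 0)" if "e \<in> E" "f \<in> E" for e f
    using on[OF that] by (simp add: inner_outer)
  have "inj_on outer E"
    using io by (intro inj_onI) (metis zero_neq_one)
  moreover have "independent (outer ` E)"
  proof (rule pairwise_orthogonal_independent)
    show "pairwise orthogonal (outer ` E)"
      using io by (auto simp: pairwise_def orthogonal_def)
    show "0 \<notin> outer ` E"
      using io by (metis image_iff inner_zero_left zero_neq_one)
  qed
  ultimately show "dim (span (outer ` E)) = card E"
    by (simp add: dim_eq_card_independent card_image)
  show "transpose M = M" if "M \<in> span (outer ` E)"
    using that
  proof (induction rule: span_induct)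
    case base
    show ?case
      by (rule subspace_sym)
  next
    case (step M)
    then show ?case
      by (auto simp: outer_def vec_eq_iff transpose_component)
  qed
  show "N ** cnj_mat M = M ** cnj_mat N" if "M \<in> span (outer ` E)" "N \<in> span (outer ` E)"
  proof -
    have sub: "subspace {M. N ** cnj_mat M = M ** cnj_mat N}" for N :: "complex^'n^'n"
      by (rule subspaceI) (simp_all add: cnj_mat_add cnj_mat_scaleR matrix_distribs,
          simp add: vec_eq_iff matrix_mult_component)
    have 1: "outer f ** cnj_mat M = M ** cnj_mat (outer f)" if "f \<in> E" for f
      using \<open>M \<in> span (outer ` E)\<close>
    proof (induction rule: span_induct)
      case base
      show ?case
        by (rule sub)
    next
      case (step M)
      then obtain e where "e \<in> E" "M = outer e"
        by blast
      then show ?case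
        using that by (cases "e = f") (simp_all add: outer_mult_cnj_outer on)
    qed
    show ?thesis
      using \<open>N \<in> span (outer ` E)\<close>
    proof (induction rule: span_induct)
      case base
      show ?case
        using sub[of M] by (simp add: eq_commute)
    next
      case (step N)
      then show ?case
        using 1 by blast
    qed
  qed
qed

lemma dim_cartan_subspace:
  fixes a :: "(complex^('n::finite + 'n)^('n + 'n)) set"
  assumes "cartan_subspace sp_m a"
  shows "dim a = CARD('n)"
proof -
  have a: "a \<subseteq> sp_m" "abelian_subspace a"
    and max: "\<And>b. b \<subseteq> sp_m \<Longrightarrow> abelian_subspace b \<Longrightarrow> a \<subseteq> b \<Longrightarrow> b = a"
    using assms by (auto simp: cartan_subspace_def)
  have sym: "transpose M = M" if "M \<in> m_id ` a" for M :: "complex^'n^'n"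
    using that a(1) m_id_sym by blast
  have comm: "M ** cnj_mat N = N ** cnj_mat M" if MN: "M \<in> m_id ` a" "N \<in> m_id ` a"
    for M N :: "complex^'n^'n"
  proof -
    obtain X Y where XY: "X \<in> a" "Y \<in> a" "M = m_id X" "N = m_id Y"
      using MN by blast
    have "X \<in> sp_m" "Y \<in> sp_m" "bracket X Y = 0"
      using a XY by (auto simp: abelian_subspace_def)
    then show ?thesis
      using bracket_m_m_eq_0_iff[of X Y] XY by simp
  qed
  obtain E where card: "card E = CARD('n)"
    and on: "\<And>e f. e \<in> E \<Longrightarrow> f \<in> E \<Longrightarrow> herm e f = (if e = f then 1 else 0)"
    and sub: "m_id ` a \<subseteq> span (outer ` E)"
    by (rule simultaneous_takagi[of "m_id ` a", OF sym comm]) auto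
  note so = span_outer[of E, OF on]
  \<comment> \<open>An abelian subspace of dimension n around a; maximality of a gives
    equality.\<close>
  define b where "b = {X \<in> sp_m. m_id X \<in> span (outer ` E)}"
  have "subspace b"
    unfolding b_def by (rule subspace_m_id_vimage[OF subspace_span])
  moreover have "bracket X Y = 0" if "X \<in> b" "Y \<in> b" for X Y
    using that so(3) by (subst bracket_m_m_eq_0_iff) (auto simp: b_def)
  ultimately have "abelian_subspace b"
    by (simp add: abelian_subspace_def)
  moreover have "a \<subseteq> b" "b \<subseteq> sp_m"
    using a(1) sub by (auto simp: b_def)
  ultimately have "b = a"
    by (intro max)
  have "dim b = dim (span (outer ` E))"
    unfolding b_def by (rule dim_m_id_vimage[OF subspace_span so(2)])
  then show ?thesis
    using \<open>b = a\<close> so(1) card by metis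
qed

lemma has_rank_sp_m: "has_rank (sp_m :: (complex^('n::finite + 'n)^('n + 'n)) set) CARD('n)"
  unfolding has_rank_def using cartan_diag_subspace dim_cartan_subspace by blast

section \<open>The structure of the symmetric pair\<close>

theorem lemma1:
  fixes \<gg> \<hh> \<mm> \<aa> :: "(complex^('n::finite + 'n)^('n + 'n)) set"
  assumes "\<gg> = sp" and "\<hh> = sp_h" and "\<mm> = sp_m" and "\<aa> = diag_subspace"
  shows
    "(\<gg> = {X + Y | X Y. X \<in> \<hh> \<and> Y \<in> \<mm>} \<and> \<hh> \<inter> \<mm> = {0} \<and>
     \<mm> = {m_elt A B | A B. transpose A = A \<and> transpose B = B} \<and>
     \<hh> = {h_elt C D | C D. transpose C = - C \<and> transpose D = D})
     \<and>
     (subspace \<mm> \<and> linear (m_id :: _ \<Rightarrow> complex^'n^'n) \<and>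
     (\<forall>A B :: real^'n^'n. m_id (m_elt A B) = cmat A B) \<and>
     bij_betw m_id \<mm> {A\<^sub>1 :: complex^'n^'n. transpose A\<^sub>1 - A\<^sub>1 = 0} \<and>
     lie_subalgebra \<hh> \<gg> \<and> linear (h_id :: _ \<Rightarrow> complex^'n^'n) \<and>
     (\<forall>C D :: real^'n^'n. h_id (h_elt C D) = cmat C D) \<and>
     bij_betw h_id \<hh> {C\<^sub>1 :: complex^'n^'n. transpose (cnj_mat C\<^sub>1) + C\<^sub>1 = 0})
     \<and>
     ((\<forall>X\<in>\<mm>. \<forall>Y\<in>\<mm>. bracket X Y \<in> \<hh> \<and>
        h_id (bracket X Y) = m_id Y ** cnj_mat (m_id X) - m_id X ** cnj_mat (m_id Y)) \<and>
     (\<forall>X\<in>\<mm>. \<forall>Y\<in>\<hh>. bracket X Y \<in> \<mm> \<and>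
        m_id (bracket X Y) = m_id X ** cnj_mat (h_id Y) - h_id Y ** m_id X) \<and>
     (\<forall>X\<in>\<hh>. \<forall>Y\<in>\<hh>. bracket X Y \<in> \<hh> \<and>
        h_id (bracket X Y) = h_id X ** h_id Y - h_id Y ** h_id X))
     \<and>
     (neg_def_inner_product_on \<mm> (killing_form \<gg>) \<and>
     (\<forall>X\<in>\<mm>. \<forall>Y\<in>\<mm>.
        killing_form \<gg> X Y
          = - 4 * (real CARD('n) + 1) * Re (trace (m_id X ** cnj_mat (m_id Y))) \<and>
        killing_form sp_complex X Y
          = - 8 * (real CARD('n) + 1) * Re (trace (m_id X ** cnj_mat (m_id Y)))))
     \<and>
     (dim \<mm> = CARD('n)\<^sup>2 + CARD('n) \<and> has_rank \<mm> CARD('n) \<and>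
     subspace \<aa> \<and> \<aa> \<subseteq> \<mm> \<and> dim \<aa> = CARD('n) \<and> cartan_subspace \<mm> \<aa>)"
  unfolding assms
proof (intro conjI)
  show "\<forall>A B :: real^'n^'n. m_id (m_elt A B) = cmat A B" "\<forall>C D :: real^'n^'n. h_id (h_elt C D) = cmat C D"
    by (simp_all add: m_id_m_elt h_id_h_elt)
  show "bij_betw m_id sp_m {A\<^sub>1 :: complex^'n^'n. transpose A\<^sub>1 - A\<^sub>1 = 0}"
    using bij_betw_m_id by simp
qed (auto simp only: sp_decomposition[symmetric] sp_h_inter_sp_m sp_m_eq[symmetric] sp_h_eq[symmetric]
    subspace_sp_m linear_m_id lie_subalgebra_sp_h linear_h_id bij_betw_h_id bracket_m_m bracket_m_h
    bracket_h_h h_id_bracket_m_m m_id_bracket_m_h h_id_bracket_h_h neg_def_killing_form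
    killing_form_sp_m dim_sp_m has_rank_sp_m subspace_diag diag_subspace_subset dim_diag_subspace
    cartan_diag_subspace)

end
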